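(* Let $H\subseteq G$ be a roughly normal subgroup and let $G\overset{\sigma}{\curvearrowright}(X,\mu)$ be a free mixing p.m.p. action. Suppose that $\mathsf{P}$ is a von Neumann algebra such that $L^\infty(X)\rtimes H<\mathsf{P}<L^\infty(X)\rtimes G$. Then $\mathsf{P}=L^\infty(X)\rtimes K$ for some group $K$ with $H<K<G$.
   Context: All groups are discrete and countable; p.m.p. means probability measure preserving; inclusions of von Neumann algebras are unital; $<$ denotes (not necessarily proper) inclusion as a subgroup or von Neumann subalgebra. An infinite subgroup $H<G$ is called roughly normal if for every $g\in G$ the set $H\cap g^{-1}Hg$ is infinite. *)

theory Defs
  imports "HOL-Probability.Probability" "HOL-Algebra.Group_Action"
begin

section \<open>Bounded operators and von Neumann algebras on a complex Hilbert space\<close>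

text \<open>Hilbert spaces are given by explicit carriers, since the underlying set of the \<open>L\<^sup>2\<close>-space of a
  measure depends on the measure.\<close>

record 'h hilbert =
  hcarrier :: "'h set"
  hadd :: "'h \<Rightarrow> 'h \<Rightarrow> 'h"
  hscale :: "complex \<Rightarrow> 'h \<Rightarrow> 'h"
  hinner :: "'h \<Rightarrow> 'h \<Rightarrow> complex"

definition hnorm :: "'h hilbert \<Rightarrow> 'h \<Rightarrow> real" where
  "hnorm V \<xi> = sqrt (Re (hinner V \<xi> \<xi>))"

text \<open>Operators are extensional functions on the carrier, so that equality of operators is equality
  in HOL.\<close>

definition bounded_operators :: "'h hilbert \<Rightarrow> ('h \<Rightarrow> 'h) set" where
  "bounded_operators V =
     {T \<in> hcarrier V \<rightarrow>\<^sub>E hcarrier V.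
        (\<forall>\<xi>\<in>hcarrier V. \<forall>\<eta>\<in>hcarrier V. T (hadd V \<xi> \<eta>) = hadd V (T \<xi>) (T \<eta>)) \<and>
        (\<forall>c. \<forall>\<xi>\<in>hcarrier V. T (hscale V c \<xi>) = hscale V c (T \<xi>)) \<and>
        (\<exists>C. \<forall>\<xi>\<in>hcarrier V. hnorm V (T \<xi>) \<le> C * hnorm V \<xi>)}"

definition is_adjoint :: "'h hilbert \<Rightarrow> ('h \<Rightarrow> 'h) \<Rightarrow> ('h \<Rightarrow> 'h) \<Rightarrow> bool" where
  "is_adjoint V T S \<longleftrightarrow>
     (\<forall>\<xi>\<in>hcarrier V. \<forall>\<eta>\<in>hcarrier V. hinner V (T \<xi>) \<eta> = hinner V \<xi> (S \<eta>))"

definition commutant :: "'h hilbert \<Rightarrow> ('h \<Rightarrow> 'h) set \<Rightarrow> ('h \<Rightarrow> 'h) set" where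
  "commutant V S =
     {T \<in> bounded_operators V. \<forall>A\<in>S. \<forall>\<xi>\<in>hcarrier V. T (A \<xi>) = A (T \<xi>)}"

definition von_neumann_algebra :: "'h hilbert \<Rightarrow> ('h \<Rightarrow> 'h) set \<Rightarrow> bool" where
  "von_neumann_algebra V P \<longleftrightarrow>
     P \<subseteq> bounded_operators V \<and>
     (\<forall>T\<in>P. \<exists>S\<in>P. is_adjoint V T S) \<and>
     commutant V (commutant V P) = P"


section \<open>The Hilbert space of square-integrable functions\<close>

definition sq_integrable :: "'a measure \<Rightarrow> ('a \<Rightarrow> complex) \<Rightarrow> bool" where
  "sq_integrable N f \<longleftrightarrow> f \<in> borel_measurable N \<and> integrable N (\<lambda>z. (cmod (f z))\<^sup>2)"

definition L2_rel :: "'a measure \<Rightarrow> (('a \<Rightarrow> complex) \<times> ('a \<Rightarrow> complex)) set" where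
  "L2_rel N = {(f, g). sq_integrable N f \<and> sq_integrable N g \<and> (AE z in N. f z = g z)}"

definition L2_class :: "'a measure \<Rightarrow> ('a \<Rightarrow> complex) \<Rightarrow> ('a \<Rightarrow> complex) set" where
  "L2_class N f = L2_rel N `` {f}"

definition L2_rep :: "('a \<Rightarrow> complex) set \<Rightarrow> 'a \<Rightarrow> complex" where
  "L2_rep \<xi> = (SOME f. f \<in> \<xi>)"

definition L2 :: "'a measure \<Rightarrow> ('a \<Rightarrow> complex) set hilbert" where
  "L2 N =
     \<lparr>hcarrier = Collect (sq_integrable N) // L2_rel N,
      hadd = (\<lambda>\<xi> \<eta>. L2_class N (\<lambda>z. L2_rep \<xi> z + L2_rep \<eta> z)),
      hscale = (\<lambda>c \<xi>. L2_class N (\<lambda>z. c * L2_rep \<xi> z)),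
      hinner = (\<lambda>\<xi> \<eta>. integral\<^sup>L N (\<lambda>z. L2_rep \<xi> z * cnj (L2_rep \<eta> z)))\<rparr>"

definition ess_bounded :: "'a measure \<Rightarrow> ('a \<Rightarrow> complex) \<Rightarrow> bool" where
  "ess_bounded N a \<longleftrightarrow> a \<in> borel_measurable N \<and> (\<exists>C. AE z in N. cmod (a z) \<le> C)"


section \<open>Group actions on probability spaces\<close>

definition standard_probability_space :: "'x measure \<Rightarrow> bool" where
  "standard_probability_space M \<longleftrightarrow>
     prob_space M \<and>
     (\<exists>T. completely_metrizable_space T \<and> second_countable T \<and> topspace T = space M \<and>
          sets M = sigma_sets (topspace T) {U. openin T U})"

definition pmp_action ::
    "('g, 'm) monoid_scheme \<Rightarrow> 'x measure \<Rightarrow> ('g \<Rightarrow> 'x \<Rightarrow> 'x) \<Rightarrow> bool" where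
  "pmp_action G M \<sigma> \<longleftrightarrow>
     group_action G (space M) \<sigma> \<and>
     (\<forall>g\<in>carrier G. \<sigma> g \<in> measurable M M \<and> distr M M (\<sigma> g) = M)"

definition free_action ::
    "('g, 'm) monoid_scheme \<Rightarrow> 'x measure \<Rightarrow> ('g \<Rightarrow> 'x \<Rightarrow> 'x) \<Rightarrow> bool" where
  "free_action G M \<sigma> \<longleftrightarrow> (\<forall>g\<in>carrier G - {\<one>\<^bsub>G\<^esub>}. AE x in M. \<sigma> g x \<noteq> x)"

text \<open>The filter below describes \<open>g \<rightarrow> \<infinity>\<close> in the discrete group \<open>G\<close>.\<close>

definition mixing_action ::
    "('g, 'm) monoid_scheme \<Rightarrow> 'x measure \<Rightarrow> ('g \<Rightarrow> 'x \<Rightarrow> 'x) \<Rightarrow> bool" where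
  "mixing_action G M \<sigma> \<longleftrightarrow>
     (\<forall>A\<in>sets M. \<forall>B\<in>sets M.
        ((\<lambda>g. measure M (\<sigma> g ` A \<inter> B)) \<longlongrightarrow> measure M A * measure M B)
          (inf cofinite (principal (carrier G))))"

definition roughly_normal :: "('g, 'm) monoid_scheme \<Rightarrow> 'g set \<Rightarrow> bool" where
  "roughly_normal G H \<longleftrightarrow>
     subgroup H G \<and> infinite H \<and>
     (\<forall>g\<in>carrier G. infinite (H \<inter> (inv\<^bsub>G\<^esub> g <#\<^bsub>G\<^esub> H #>\<^bsub>G\<^esub> g)))"


section \<open>Crossed products\<close>

text \<open>The group measure space construction on \<open>L\<^sup>2(X \<times> G) = L\<^sup>2(X) \<otimes> \<ell>\<^sup>2(G)\<close>: a function \<open>a\<close> acts as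
  \<open>a \<otimes> 1\<close>, and \<open>g\<close> acts as \<open>\<sigma>\<^sub>g \<otimes> \<lambda>\<^sub>g\<close>, where \<open>\<sigma>\<^sub>g(\<xi>) = \<xi> \<circ> \<sigma> (inv g)\<close>; these satisfy
  \<open>u\<^sub>g a u\<^sub>g\<^sup>* = \<sigma>\<^sub>g(a)\<close>.\<close>

abbreviation XG_measure :: "('g, 'm) monoid_scheme \<Rightarrow> 'x measure \<Rightarrow> ('x \<times> 'g) measure" where
  "XG_measure G M \<equiv> M \<Otimes>\<^sub>M count_space (carrier G)"

abbreviation XG_L2 ::
    "('g, 'm) monoid_scheme \<Rightarrow> 'x measure \<Rightarrow> ('x \<times> 'g \<Rightarrow> complex) set hilbert" where
  "XG_L2 G M \<equiv> L2 (XG_measure G M)"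

definition mult_op ::
    "('g, 'm) monoid_scheme \<Rightarrow> 'x measure \<Rightarrow> ('x \<Rightarrow> complex) \<Rightarrow>
     ('x \<times> 'g \<Rightarrow> complex) set \<Rightarrow> ('x \<times> 'g \<Rightarrow> complex) set" where
  "mult_op G M a =
     (\<lambda>\<xi>\<in>hcarrier (XG_L2 G M). L2_class (XG_measure G M) (\<lambda>(x, k). a x * L2_rep \<xi> (x, k)))"

definition group_op ::
    "('g, 'm) monoid_scheme \<Rightarrow> 'x measure \<Rightarrow> ('g \<Rightarrow> 'x \<Rightarrow> 'x) \<Rightarrow> 'g \<Rightarrow>
     ('x \<times> 'g \<Rightarrow> complex) set \<Rightarrow> ('x \<times> 'g \<Rightarrow> complex) set" where
  "group_op G M \<sigma> g =
     (\<lambda>\<xi>\<in>hcarrier (XG_L2 G M). L2_class (XG_measure G M)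
        (\<lambda>(x, k). L2_rep \<xi> (\<sigma> (inv\<^bsub>G\<^esub> g) x, inv\<^bsub>G\<^esub> g \<otimes>\<^bsub>G\<^esub> k)))"

text \<open>For a subgroup \<open>K\<close> of \<open>G\<close>, the crossed product by \<open>K\<close> is the von Neumann subalgebra of the
  crossed product by \<open>G\<close> that is generated by \<open>L\<^sup>\<infinity>(X)\<close> and \<open>u\<^sub>k\<close> for \<open>k \<in> K\<close>.  All of these algebras
  act on the same space \<open>L\<^sup>2(X \<times> G)\<close>, so the inclusions between them are unital inclusions of sets of
  operators.\<close>

definition crossed_product ::
    "('g, 'm) monoid_scheme \<Rightarrow> 'x measure \<Rightarrow> ('g \<Rightarrow> 'x \<Rightarrow> 'x) \<Rightarrow> 'g set \<Rightarrow>
     (('x \<times> 'g \<Rightarrow> complex) set \<Rightarrow> ('x \<times> 'g \<Rightarrow> complex) set) set" where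
  "crossed_product G M \<sigma> K =
     commutant (XG_L2 G M) (commutant (XG_L2 G M)
       (mult_op G M ` {a. ess_bounded M a} \<union> group_op G M \<sigma> ` K))"

end

theory Submission
  imports Defs
begin

text \<open>
  Let \<open>x = \<Sum>\<^sub>g x\<^sub>g u\<^sub>g\<close> be in \<open>P\<close>.  Pinching \<open>x\<close> to \<open>\<Sum>\<^sub>i 1\<^bsub>A\<^sub>i\<^esub> x 1\<^bsub>k\<^sup>-\<^sup>1A\<^sub>i\<^esub>\<close> along partitions \<open>(A\<^sub>i)\<close>
  that get finer and finer leaves only the term \<open>x\<^sub>k u\<^sub>k\<close>, because the action is free; hence \<open>x\<^sub>k u\<^sub>k \<in> P\<close>.
  If \<open>x\<^sub>k \<noteq> 0\<close>, then \<open>1\<^sub>B u\<^sub>k \<in> P\<close> for some \<open>B\<close> of positive measure.  Conjugation by \<open>h\<close> in the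
  infinite group \<open>H \<inter> k H k\<^sup>-\<^sup>1\<close> replaces \<open>B\<close> by \<open>h B\<close>, and by mixing the union of the translates of \<open>B\<close>
  has full measure; so \<open>u\<^sub>k \<in> P\<close>.  Thus every element of \<open>P\<close> has its Fourier support in
  \<open>K = {k. u\<^sub>k \<in> P}\<close>.  The Fourier series converges only at the trace vector \<open>\<Omega>\<close>, but the trace property
  gives the same convergence for the adjoints, and the two together suffice to pass commutation
  relations to the limit.\<close>

section \<open>Hilbert space calculus\<close>

text \<open>An element x of the crossed product is studied only through the vector x \<Omega>, a
  function on X x G whose slice at k is the coefficient of x at k. Nothing is lost: x commutes with
  all right multiplications, and these carry \<Omega> to a total set of vectors, so identities
  between elements can be checked at \<Omega>. Why pinching isolates k: since u_j 1_D = 1_{jD} u_j,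
  cutting the j-th term by 1_A on the left and by the indicator of k^-1 A on the right restricts its
  coefficient to the intersection of A and j k^-1 A. Summed over a partition, the coefficient at j
  survives at y only if y and k j^-1 y lie in the same piece. For j = k this is always so; otherwise
  countably many measurable sets that separate points remove almost every y. Why the conjugation
  uses two elements of H: u_h (1_B u_g) u_h' has its coefficient at h g h', and staying at g forces
  h' = (g^-1 h g)^-1. Both h and h' must lie in H, which is where rough normality enters. The
  obstacle is membership in P, which is known only as a double commutant: every limit has to be
  justified by commutation with the commutant of P.\<close>

lemma borel_measurable_cnj [measurable]: "(\<lambda>z::complex. cnj z) \<in> borel_measurable borel"
  by (intro borel_measurable_continuous_onI continuous_intros)

lemma sq_integrable_meas: "sq_integrable N f \<Longrightarrow> f \<in> borel_measurable N"
  by (simp add: sq_integrable_def)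

lemma sq_integrable_int: "sq_integrable N f \<Longrightarrow> integrable N (\<lambda>z. (cmod (f z))\<^sup>2)"
  by (simp add: sq_integrable_def)

lemma sq_integrable_bound:
  assumes "sq_integrable N h" "f \<in> borel_measurable N" "AE z in N. cmod (f z) \<le> c * cmod (h z)"
  shows "sq_integrable N f"
proof -
  have "integrable N (\<lambda>z. c\<^sup>2 * (cmod (h z))\<^sup>2)"
    using sq_integrable_int[OF assms(1)] by simp
  moreover have "AE z in N. norm ((cmod (f z))\<^sup>2) \<le> norm (c\<^sup>2 * (cmod (h z))\<^sup>2)"
    using assms(3)
  proof eventually_elim
    case (elim z)
    show ?case using power_mono[OF elim, of 2] by (simp add: power_mult_distrib)
  qed
  moreover have "(\<lambda>z. (cmod (f z))\<^sup>2) \<in> borel_measurable N"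
    using assms(2) by measurable
  ultimately have "integrable N (\<lambda>z. (cmod (f z))\<^sup>2)"
    using Bochner_Integration.integrable_bound by blast
  then show ?thesis using assms(2) by (simp add: sq_integrable_def)
qed

lemma cmod_add_sq: "(cmod (a + b))\<^sup>2 \<le> 2 * (cmod a)\<^sup>2 + 2 * (cmod b)\<^sup>2"
proof -
  have "(cmod (a + b))\<^sup>2 \<le> (cmod a + cmod b)\<^sup>2"
    by (intro power_mono norm_triangle_ineq) auto
  also have "\<dots> \<le> 2 * (cmod a)\<^sup>2 + 2 * (cmod b)\<^sup>2"
    using zero_le_power2[of "cmod a - cmod b"] by (simp add: power2_eq_square algebra_simps)
  finally show ?thesis .
qed

lemma sq_integrable_add:
  assumes "sq_integrable N f" "sq_integrable N g"
  shows "sq_integrable N (\<lambda>z. f z + g z)"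
proof -
  have [measurable]: "f \<in> borel_measurable N" "g \<in> borel_measurable N"
    using assms by (auto simp: sq_integrable_def)
  have "integrable N (\<lambda>z. 2 * (cmod (f z))\<^sup>2 + 2 * (cmod (g z))\<^sup>2)"
    using assms by (auto simp: sq_integrable_def)
  then have "integrable N (\<lambda>z. (cmod (f z + g z))\<^sup>2)"
    by (rule Bochner_Integration.integrable_bound) (auto intro!: AE_I2 cmod_add_sq)
  then show ?thesis by (simp add: sq_integrable_def)
qed

lemma sq_integrable_scale: "sq_integrable N f \<Longrightarrow> sq_integrable N (\<lambda>z. c * f z)"
  by (rule sq_integrable_bound[where h = f and c = "cmod c"])
     (auto simp: norm_mult sq_integrable_def)

lemma sq_integrable_diff:
  "sq_integrable N f \<Longrightarrow> sq_integrable N g \<Longrightarrow> sq_integrable N (\<lambda>z. f z - g z)"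
  using sq_integrable_add[of N f "\<lambda>z. (-1) * g z"] sq_integrable_scale[of N g "-1"] by simp

lemma integrable_mult_cnj:
  assumes "sq_integrable N f" "sq_integrable N g"
  shows "integrable N (\<lambda>z. f z * cnj (g z))"
proof -
  have [measurable]: "f \<in> borel_measurable N" "g \<in> borel_measurable N"
    using assms by (auto simp: sq_integrable_def)
  have "integrable N (\<lambda>z. (cmod (f z))\<^sup>2 + (cmod (g z))\<^sup>2)"
    using assms by (auto simp: sq_integrable_def)
  then show ?thesis
  proof (rule Bochner_Integration.integrable_bound)
    have "cmod (f z) * cmod (g z) \<le> (cmod (f z))\<^sup>2 + (cmod (g z))\<^sup>2" for z
    proof -
      have "2 * (cmod (f z) * cmod (g z)) \<le> (cmod (f z))\<^sup>2 + (cmod (g z))\<^sup>2"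
        using zero_le_power2[of "cmod (f z) - cmod (g z)"] by (simp add: power2_eq_square algebra_simps)
      moreover have "0 \<le> cmod (f z) * cmod (g z)" by simp
      ultimately show ?thesis by linarith
    qed
    then show "AE z in N. norm (f z * cnj (g z)) \<le> norm ((cmod (f z))\<^sup>2 + (cmod (g z))\<^sup>2)"
      by (auto simp: norm_mult)
  qed measurable
qed

lemma equiv_L2_rel: "equiv (Collect (sq_integrable N)) (L2_rel N)"
proof (rule equivI)
  show "trans (L2_rel N)"
    unfolding trans_def L2_rel_def
    by (auto elim: AE_mp)
qed (auto simp: refl_on_def sym_def L2_rel_def)

lemma L2_class_eq_iff:
  "sq_integrable N f \<Longrightarrow> sq_integrable N g \<Longrightarrow> L2_class N f = L2_class N g \<longleftrightarrow> (AE z in N. f z = g z)"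
  unfolding L2_class_def
  using eq_equiv_class_iff[OF equiv_L2_rel, of f N g] by (auto simp: L2_rel_def)

lemma L2_class_cong:
  assumes "sq_integrable N f" "sq_integrable N g" "AE z in N. f z = g z"
  shows "L2_class N f = L2_class N g"
  using L2_class_eq_iff assms by blast

lemma L2_class_carrier [simp, intro]: "sq_integrable N f \<Longrightarrow> L2_class N f \<in> hcarrier (L2 N)"
  by (auto simp: L2_def L2_class_def quotientI)

lemma L2_rep_mem:
  assumes "\<xi> \<in> hcarrier (L2 N)"
  shows "sq_integrable N (L2_rep \<xi>)" "L2_class N (L2_rep \<xi>) = \<xi>"
proof -
  obtain f where f: "sq_integrable N f" "\<xi> = L2_rel N `` {f}"
    using assms by (auto simp: L2_def quotient_def)
  have "f \<in> \<xi>" using f by (auto simp: L2_rel_def)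
  then have "L2_rep \<xi> \<in> \<xi>" unfolding L2_rep_def by (rule someI[where P = "\<lambda>f. f \<in> \<xi>"])
  then have r: "(f, L2_rep \<xi>) \<in> L2_rel N" using f by auto
  then show "sq_integrable N (L2_rep \<xi>)" by (auto simp: L2_rel_def)
  show "L2_class N (L2_rep \<xi>) = \<xi>"
    using equiv_class_eq[OF equiv_L2_rel r] f(2) unfolding L2_class_def by metis
qed

lemma L2_rep_class:
  assumes "sq_integrable N f"
  shows "AE z in N. L2_rep (L2_class N f) z = f z"
  using L2_class_eq_iff[of N "L2_rep (L2_class N f)" f] L2_rep_mem[OF L2_class_carrier[OF assms]] assms
  by auto

lemma L2_cases:
  assumes "\<xi> \<in> hcarrier (L2 N)"
  obtains f where "sq_integrable N f" "\<xi> = L2_class N f"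
  using L2_rep_mem[OF assms] by metis

lemma hadd_class:
  assumes f: "sq_integrable N f" and g: "sq_integrable N g"
  shows "hadd (L2 N) (L2_class N f) (L2_class N g) = L2_class N (\<lambda>z. f z + g z)"
  unfolding L2_def hilbert.simps
proof (rule L2_class_cong)
  show "AE z in N. L2_rep (L2_class N f) z + L2_rep (L2_class N g) z = f z + g z"
    using L2_rep_class[OF f] L2_rep_class[OF g] by eventually_elim simp
qed (use f g in \<open>auto intro!: sq_integrable_add L2_rep_mem\<close>)

lemma hscale_class:
  assumes f: "sq_integrable N f"
  shows "hscale (L2 N) c (L2_class N f) = L2_class N (\<lambda>z. c * f z)"
  unfolding L2_def hilbert.simps
proof (rule L2_class_cong)
  show "AE z in N. c * L2_rep (L2_class N f) z = c * f z"
    using L2_rep_class[OF f] by eventually_elim simp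
qed (use f in \<open>auto intro!: sq_integrable_scale L2_rep_mem\<close>)

lemma hinner_class:
  assumes f: "sq_integrable N f" and g: "sq_integrable N g"
  shows "hinner (L2 N) (L2_class N f) (L2_class N g) = (\<integral>z. f z * cnj (g z) \<partial>N)"
  unfolding L2_def hilbert.simps
proof (rule integral_cong_AE)
  have [measurable]: "L2_rep (L2_class N f) \<in> borel_measurable N" "L2_rep (L2_class N g) \<in> borel_measurable N"
    "f \<in> borel_measurable N" "g \<in> borel_measurable N"
    using f g by (auto intro!: sq_integrable_meas L2_rep_mem)
  show "(\<lambda>z. L2_rep (L2_class N f) z * cnj (L2_rep (L2_class N g) z)) \<in> borel_measurable N"
    "(\<lambda>z. f z * cnj (g z)) \<in> borel_measurable N" by measurable
  show "AE z in N. L2_rep (L2_class N f) z * cnj (L2_rep (L2_class N g) z) = f z * cnj (g z)"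
    using L2_rep_class[OF f] L2_rep_class[OF g] by eventually_elim simp
qed

lemma hnorm_class:
  assumes f: "sq_integrable N f"
  shows "hnorm (L2 N) (L2_class N f) = sqrt (\<integral>z. (cmod (f z))\<^sup>2 \<partial>N)"
proof -
  have "(\<integral>z. f z * cnj (f z) \<partial>N) = (\<integral>z. complex_of_real ((cmod (f z))\<^sup>2) \<partial>N)"
    by (rule arg_cong[of _ _ "integral\<^sup>L N"], rule ext) (metis complex_norm_square)
  then show ?thesis
    unfolding hnorm_def hinner_class[OF f f] integral_complex_of_real by simp
qed

lemma hnorm_nonneg: "\<xi> \<in> hcarrier (L2 N) \<Longrightarrow> 0 \<le> hnorm (L2 N) \<xi>"
  by (erule L2_cases) (simp add: hnorm_class)

lemma hadd_carrier: "\<xi> \<in> hcarrier (L2 N) \<Longrightarrow> \<eta> \<in> hcarrier (L2 N) \<Longrightarrow> hadd (L2 N) \<xi> \<eta> \<in> hcarrier (L2 N)"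
  by (elim L2_cases) (auto simp: hadd_class intro!: sq_integrable_add)

lemma hscale_carrier: "\<xi> \<in> hcarrier (L2 N) \<Longrightarrow> hscale (L2 N) c \<xi> \<in> hcarrier (L2 N)"
  by (elim L2_cases) (auto simp: hscale_class intro!: sq_integrable_scale)

lemma hnorm_add_sq:
  assumes "\<xi> \<in> hcarrier (L2 N)" "\<eta> \<in> hcarrier (L2 N)"
  shows "(hnorm (L2 N) (hadd (L2 N) \<xi> \<eta>))\<^sup>2 \<le> 2 * (hnorm (L2 N) \<xi>)\<^sup>2 + 2 * (hnorm (L2 N) \<eta>)\<^sup>2"
proof -
  obtain f g where f: "sq_integrable N f" "\<xi> = L2_class N f" and g: "sq_integrable N g" "\<eta> = L2_class N g"
    using assms by (metis L2_cases)
  have i: "integrable N (\<lambda>z. (cmod (f z))\<^sup>2)" "integrable N (\<lambda>z. (cmod (g z))\<^sup>2)"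
    using f g by (auto simp: sq_integrable_def)
  have "(\<integral>z. (cmod (f z + g z))\<^sup>2 \<partial>N) \<le> (\<integral>z. 2 * (cmod (f z))\<^sup>2 + 2 * (cmod (g z))\<^sup>2 \<partial>N)"
    using i by (intro integral_mono sq_integrable_int sq_integrable_add f g cmod_add_sq) auto
  also have "\<dots> = 2 * (\<integral>z. (cmod (f z))\<^sup>2 \<partial>N) + 2 * (\<integral>z. (cmod (g z))\<^sup>2 \<partial>N)"
    using i by simp
  finally show ?thesis
    using f g by (simp add: hadd_class hnorm_class sq_integrable_add)
qed

text \<open>The form of commutativity and associativity that makes a sum of two additive operators
  additive.\<close>

lemma hadd_interchange:
  assumes "a \<in> hcarrier (L2 N)" "b \<in> hcarrier (L2 N)" "c \<in> hcarrier (L2 N)" "d \<in> hcarrier (L2 N)"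
  shows "hadd (L2 N) (hadd (L2 N) a b) (hadd (L2 N) c d) = hadd (L2 N) (hadd (L2 N) a c) (hadd (L2 N) b d)"
  using assms
  by (elim L2_cases) (simp add: hadd_class sq_integrable_add algebra_simps)

lemma hscale_hadd:
  assumes "a \<in> hcarrier (L2 N)" "b \<in> hcarrier (L2 N)"
  shows "hscale (L2 N) r (hadd (L2 N) a b) = hadd (L2 N) (hscale (L2 N) r a) (hscale (L2 N) r b)"
  using assms
  by (elim L2_cases) (simp add: hadd_class hscale_class sq_integrable_add sq_integrable_scale algebra_simps)

lemma hinner_sym:
  assumes "a \<in> hcarrier (L2 N)" "b \<in> hcarrier (L2 N)"
  shows "hinner (L2 N) b a = cnj (hinner (L2 N) a b)"
  using assms
  by (elim L2_cases) (simp add: hinner_class mult.commute flip: Bochner_Integration.integral_cnj)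

lemma hinner_add_left:
  assumes "a \<in> hcarrier (L2 N)" "b \<in> hcarrier (L2 N)" "c \<in> hcarrier (L2 N)"
  shows "hinner (L2 N) (hadd (L2 N) a b) c = hinner (L2 N) a c + hinner (L2 N) b c"
  using assms
  by (elim L2_cases)
     (simp add: hinner_class hadd_class sq_integrable_add integrable_mult_cnj distrib_right)

lemma hinner_scale_left:
  assumes "a \<in> hcarrier (L2 N)" "c \<in> hcarrier (L2 N)"
  shows "hinner (L2 N) (hscale (L2 N) r a) c = r * hinner (L2 N) a c"
  using assms
  by (elim L2_cases)
     (simp add: hinner_class hscale_class sq_integrable_scale mult.assoc)

lemma hinner_add_right:
  assumes "a \<in> hcarrier (L2 N)" "b \<in> hcarrier (L2 N)" "c \<in> hcarrier (L2 N)"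
  shows "hinner (L2 N) c (hadd (L2 N) a b) = hinner (L2 N) c a + hinner (L2 N) c b"
  using hinner_sym[OF hadd_carrier[OF assms(1,2)] assms(3)] hinner_sym[OF assms(1,3)] hinner_sym[OF assms(2,3)]
    hinner_add_left[OF assms] by simp

lemma hinner_bound:
  assumes "a \<in> hcarrier (L2 N)" "b \<in> hcarrier (L2 N)"
  shows "cmod (hinner (L2 N) a b) \<le> hnorm (L2 N) a * hnorm (L2 N) b"
proof -
  obtain f g where f: "sq_integrable N f" "a = L2_class N f" and g: "sq_integrable N g" "b = L2_class N g"
    using assms by (metis L2_cases)
  have [measurable]: "f \<in> borel_measurable N" "g \<in> borel_measurable N"
    using f g by (auto simp: sq_integrable_def)
  have i: "integrable N (\<lambda>z. (cmod (f z))\<^sup>2)" "integrable N (\<lambda>z. (cmod (g z))\<^sup>2)"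
    using f g by (auto simp: sq_integrable_def)
  have ifg: "integrable N (\<lambda>z. cmod (f z) * cmod (g z))"
    using integrable_norm[OF integrable_mult_cnj[OF f(1) g(1)]] by (simp add: norm_mult)
  have "cmod (\<integral>z. f z * cnj (g z) \<partial>N) \<le> (\<integral>z. cmod (f z) * cmod (g z) \<partial>N)"
    using integral_norm_bound[of N "\<lambda>z. f z * cnj (g z)"] by (simp add: norm_mult)
  \<comment> \<open>Cauchy-Schwarz is taken from its version for nonnegative integrals; as all
    integrals involved are finite, the inequality returns from \<open>ennreal\<close> to the
    reals.\<close>
  moreover have "ennreal ((\<integral>z. cmod (f z) * cmod (g z) \<partial>N)\<^sup>2)
      \<le> ennreal ((\<integral>z. (cmod (f z))\<^sup>2 \<partial>N) * (\<integral>z. (cmod (g z))\<^sup>2 \<partial>N))"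
    using Cauchy_Schwarz_nn_integral[of "\<lambda>z. ennreal (cmod (f z))" N "\<lambda>z. ennreal (cmod (g z))"] i ifg
    by (simp add: nn_integral_eq_integral ennreal_power ennreal_mult'[symmetric])
  then have "(\<integral>z. cmod (f z) * cmod (g z) \<partial>N)\<^sup>2 \<le> (\<integral>z. (cmod (f z))\<^sup>2 \<partial>N) * (\<integral>z. (cmod (g z))\<^sup>2 \<partial>N)"
    by (subst (asm) ennreal_le_iff) auto
  then have "(\<integral>z. cmod (f z) * cmod (g z) \<partial>N) \<le> sqrt ((\<integral>z. (cmod (f z))\<^sup>2 \<partial>N) * (\<integral>z. (cmod (g z))\<^sup>2 \<partial>N))"
    by (rule real_le_rsqrt)
  ultimately show ?thesis
    using f g by (simp add: hinner_class hnorm_class real_sqrt_mult)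
qed

section \<open>Norm convergence and the separation of vectors by inner products\<close>

definition hlim :: "'h hilbert \<Rightarrow> (nat \<Rightarrow> 'h) \<Rightarrow> 'h \<Rightarrow> bool" where
  "hlim V X \<xi> \<longleftrightarrow> (\<lambda>n. hnorm V (hadd V (X n) (hscale V (-1) \<xi>))) \<longlonglongrightarrow> 0"

lemma hlim_inner:
  assumes lim: "hlim (L2 N) X \<xi>" and c: "\<And>n. X n \<in> hcarrier (L2 N)" "\<xi> \<in> hcarrier (L2 N)" "\<eta> \<in> hcarrier (L2 N)"
  shows "(\<lambda>n. hinner (L2 N) (X n) \<eta>) \<longlonglongrightarrow> hinner (L2 N) \<xi> \<eta>"
proof -
  have "(\<lambda>n. hinner (L2 N) (X n) \<eta> - hinner (L2 N) \<xi> \<eta>) \<longlonglongrightarrow> 0"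
  proof (rule Lim_null_comparison)
    show "(\<lambda>n. hnorm (L2 N) (hadd (L2 N) (X n) (hscale (L2 N) (-1) \<xi>)) * hnorm (L2 N) \<eta>) \<longlonglongrightarrow> 0"
      using tendsto_mult_left_zero[OF lim[unfolded hlim_def]] by simp
    show "\<forall>\<^sub>F n in sequentially. cmod (hinner (L2 N) (X n) \<eta> - hinner (L2 N) \<xi> \<eta>)
      \<le> hnorm (L2 N) (hadd (L2 N) (X n) (hscale (L2 N) (-1) \<xi>)) * hnorm (L2 N) \<eta>"
    proof (rule always_eventually, rule allI)
      fix n
      have "hinner (L2 N) (X n) \<eta> - hinner (L2 N) \<xi> \<eta> = hinner (L2 N) (hadd (L2 N) (X n) (hscale (L2 N) (-1) \<xi>)) \<eta>"
        using c by (simp add: hinner_add_left hinner_scale_left hscale_carrier)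
      then show "cmod (hinner (L2 N) (X n) \<eta> - hinner (L2 N) \<xi> \<eta>)
          \<le> hnorm (L2 N) (hadd (L2 N) (X n) (hscale (L2 N) (-1) \<xi>)) * hnorm (L2 N) \<eta>"
        using c by (auto intro!: hinner_bound hadd_carrier hscale_carrier)
    qed
  qed
  then show ?thesis by (simp add: LIM_zero_iff)
qed

lemma hlim_inner_right:
  assumes "hlim (L2 N) X \<xi>" "\<And>n. X n \<in> hcarrier (L2 N)" "\<xi> \<in> hcarrier (L2 N)" "\<eta> \<in> hcarrier (L2 N)"
  shows "(\<lambda>n. hinner (L2 N) \<eta> (X n)) \<longlonglongrightarrow> hinner (L2 N) \<eta> \<xi>"
  using tendsto_cnj[OF hlim_inner[OF assms]] assms hinner_sym[of _ N \<eta>] by simp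

text \<open>Testing with the difference of the two vectors shows that this difference has norm
  0.\<close>

lemma L2_eqI_inner:
  assumes "a \<in> hcarrier (L2 N)" "b \<in> hcarrier (L2 N)"
    and "\<And>c. c \<in> hcarrier (L2 N) \<Longrightarrow> hinner (L2 N) a c = hinner (L2 N) b c"
  shows "a = b"
proof -
  obtain f g where f: "sq_integrable N f" "a = L2_class N f" and g: "sq_integrable N g" "b = L2_class N g"
    using assms(1,2) by (metis L2_cases)
  have d: "sq_integrable N (\<lambda>z. f z - g z)" using f g by (auto intro: sq_integrable_diff)
  have "(\<integral>z. f z * cnj (f z - g z) \<partial>N) = (\<integral>z. g z * cnj (f z - g z) \<partial>N)"
    using assms(3)[OF L2_class_carrier[OF d]] f g d by (simp add: hinner_class del: complex_cnj_diff)
  then have "(\<integral>z. (f z - g z) * cnj (f z - g z) \<partial>N) = 0"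
    using Bochner_Integration.integral_diff[OF integrable_mult_cnj[OF f(1) d] integrable_mult_cnj[OF g(1) d]]
    by (simp add: left_diff_distrib)
  then have "hinner (L2 N) (L2_class N (\<lambda>z. f z - g z)) (L2_class N (\<lambda>z. f z - g z)) = 0"
    using hinner_class[OF d d] by simp
  then have "hnorm (L2 N) (L2_class N (\<lambda>z. f z - g z)) = 0"
    by (simp add: hnorm_def)
  then have "(\<integral>z. (cmod (f z - g z))\<^sup>2 \<partial>N) = 0"
    using hnorm_class[OF d] by simp
  then have "AE z in N. f z = g z"
    using integral_nonneg_eq_0_iff_AE[OF sq_integrable_int[OF d]] by simp
  then show ?thesis using L2_class_cong f g by blast
qed

lemma hlim_unique:
  assumes "hlim (L2 N) X \<xi>" "hlim (L2 N) X \<eta>"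
    and c: "\<And>n. X n \<in> hcarrier (L2 N)" "\<xi> \<in> hcarrier (L2 N)" "\<eta> \<in> hcarrier (L2 N)"
  shows "\<xi> = \<eta>"
  using hlim_inner[OF assms(1) c(1,2)] hlim_inner[OF assms(2) c(1,3)] c(2,3)
  by (intro L2_eqI_inner) (auto intro: LIMSEQ_unique)

text \<open>The source of every concrete limit below: truncations, pinchings, partial unions and
  partial Fourier sums all converge pointwise under a fixed square-integrable bound.\<close>

lemma hlim_dominated:
  assumes f: "\<And>n. f n \<in> borel_measurable N" and g: "g \<in> borel_measurable N" and h: "sq_integrable N h"
    and lim: "AE z in N. (\<lambda>n. f n z) \<longlonglongrightarrow> g z" and bnd: "\<And>n. AE z in N. cmod (f n z) \<le> cmod (h z)"
  shows "\<And>n. sq_integrable N (f n)" "sq_integrable N g" "hlim (L2 N) (\<lambda>n. L2_class N (f n)) (L2_class N g)"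
proof -
  show sf: "sq_integrable N (f n)" for n
    by (rule sq_integrable_bound[OF h f, where c = 1]) (use bnd[of n] in simp)
  have bnd': "AE z in N. \<forall>n. cmod (f n z) \<le> cmod (h z)" using bnd by (simp add: AE_all_countable)
  have gb: "AE z in N. cmod (g z) \<le> cmod (h z)"
    using lim bnd'
  proof eventually_elim
    case (elim z)
    show ?case by (rule LIMSEQ_le_const2[OF tendsto_norm[OF elim(1)]]) (use elim(2) in auto)
  qed
  show sg: "sq_integrable N g"
    by (rule sq_integrable_bound[OF h g, where c = 1]) (use gb in simp)
  \<comment> \<open>Both \<open>f n\<close> and \<open>g\<close> are bounded by \<open>h\<close> in
    modulus, so the squared difference is at most (2 |h|)^2; hence the factor 4.\<close>
  have "(\<lambda>n. \<integral>z. (cmod (f n z - g z))\<^sup>2 \<partial>N) \<longlonglongrightarrow> (\<integral>z. 0 \<partial>N)"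
  proof (rule integral_dominated_convergence[where w = "\<lambda>z. 4 * (cmod (h z))\<^sup>2"])
    show "integrable N (\<lambda>z. 4 * (cmod (h z))\<^sup>2)" using h by (simp add: sq_integrable_def)
    show "AE z in N. (\<lambda>n. (cmod (f n z - g z))\<^sup>2) \<longlonglongrightarrow> 0"
      using lim
    proof eventually_elim
      case (elim z)
      have "(\<lambda>n. (cmod (f n z - g z))\<^sup>2) \<longlonglongrightarrow> (cmod (g z - g z))\<^sup>2"
        by (intro tendsto_intros elim)
      then show ?case by simp
    qed
    show "AE z in N. norm ((cmod (f n z - g z))\<^sup>2) \<le> 4 * (cmod (h z))\<^sup>2" for n
      using bnd[of n] gb
    proof eventually_elim
      case (elim z)
      have "cmod (f n z - g z) \<le> 2 * cmod (h z)"
        using elim norm_triangle_ineq4[of "f n z" "g z"] by linarith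
      from power_mono[OF this, of 2] show ?case by (simp add: power_mult_distrib)
    qed
  qed (use f g in measurable)
  from tendsto_real_sqrt[OF this]
  show "hlim (L2 N) (\<lambda>n. L2_class N (f n)) (L2_class N g)"
    using sf sg sq_integrable_diff[OF sf sg] sq_integrable_scale[OF sg, of "-1"]
    by (simp add: hlim_def hscale_class hadd_class hnorm_class)
qed

subsection \<open>Bounded operators\<close>

lemma bounded_op_carrier: "T \<in> bounded_operators V \<Longrightarrow> \<xi> \<in> hcarrier V \<Longrightarrow> T \<xi> \<in> hcarrier V"
  by (auto simp: bounded_operators_def)

lemma bounded_op_add:
  "T \<in> bounded_operators V \<Longrightarrow> \<xi> \<in> hcarrier V \<Longrightarrow> \<eta> \<in> hcarrier V \<Longrightarrow> T (hadd V \<xi> \<eta>) = hadd V (T \<xi>) (T \<eta>)"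
  by (auto simp: bounded_operators_def)

lemma bounded_op_scale:
  "T \<in> bounded_operators V \<Longrightarrow> \<xi> \<in> hcarrier V \<Longrightarrow> T (hscale V c \<xi>) = hscale V c (T \<xi>)"
  by (auto simp: bounded_operators_def)

lemma bounded_op_eqI:
  "S \<in> bounded_operators V \<Longrightarrow> T \<in> bounded_operators V \<Longrightarrow> (\<And>\<xi>. \<xi> \<in> hcarrier V \<Longrightarrow> S \<xi> = T \<xi>) \<Longrightarrow> S = T"
  unfolding bounded_operators_def by (auto intro: PiE_ext)

text \<open>The constant is made nonnegative so that bounds of two operators can be multiplied and
  squared.\<close>

lemma bounded_op_bound:
  assumes "T \<in> bounded_operators (L2 N)"
  obtains C where "0 \<le> C" "\<And>\<xi>. \<xi> \<in> hcarrier (L2 N) \<Longrightarrow> hnorm (L2 N) (T \<xi>) \<le> C * hnorm (L2 N) \<xi>"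
proof -
  obtain C where C: "\<And>\<xi>. \<xi> \<in> hcarrier (L2 N) \<Longrightarrow> hnorm (L2 N) (T \<xi>) \<le> C * hnorm (L2 N) \<xi>"
    using assms unfolding bounded_operators_def by blast
  have "hnorm (L2 N) (T \<xi>) \<le> \<bar>C\<bar> * hnorm (L2 N) \<xi>" if "\<xi> \<in> hcarrier (L2 N)" for \<xi>
    using C[OF that] mult_right_mono[OF abs_ge_self[of C] hnorm_nonneg[OF that]] by linarith
  then show ?thesis by (rule that[OF abs_ge_zero])
qed

lemma hlim_bounded_op:
  assumes T: "T \<in> bounded_operators (L2 N)" and lim: "hlim (L2 N) X \<xi>"
    and c: "\<And>n. X n \<in> hcarrier (L2 N)" "\<xi> \<in> hcarrier (L2 N)"
  shows "hlim (L2 N) (\<lambda>n. T (X n)) (T \<xi>)"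
proof -
  obtain C where C: "\<And>\<xi>. \<xi> \<in> hcarrier (L2 N) \<Longrightarrow> hnorm (L2 N) (T \<xi>) \<le> C * hnorm (L2 N) \<xi>"
    using bounded_op_bound[OF T] by metis
  have d: "hadd (L2 N) (X n) (hscale (L2 N) (-1) \<xi>) \<in> hcarrier (L2 N)" for n
    using c by (auto intro!: hadd_carrier hscale_carrier)
  have e: "hadd (L2 N) (T (X n)) (hscale (L2 N) (-1) (T \<xi>)) = T (hadd (L2 N) (X n) (hscale (L2 N) (-1) \<xi>))" for n
    using c by (simp add: bounded_op_add[OF T] bounded_op_scale[OF T] hscale_carrier)
  show ?thesis unfolding hlim_def e
  proof (rule Lim_null_comparison)
    show "(\<lambda>n. C * hnorm (L2 N) (hadd (L2 N) (X n) (hscale (L2 N) (-1) \<xi>))) \<longlonglongrightarrow> 0"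
      using tendsto_mult_right_zero[OF lim[unfolded hlim_def]] by simp
  qed (use C[OF d] hnorm_nonneg[OF bounded_op_carrier[OF T d]] in auto)
qed

section \<open>Sums, products, commutants and adjoints of operators\<close>

definition op_add :: "'h hilbert \<Rightarrow> ('h \<Rightarrow> 'h) \<Rightarrow> ('h \<Rightarrow> 'h) \<Rightarrow> 'h \<Rightarrow> 'h" where
  "op_add V S T = (\<lambda>\<xi>\<in>hcarrier V. hadd V (S \<xi>) (T \<xi>))"

abbreviation op_mult :: "'h hilbert \<Rightarrow> ('h \<Rightarrow> 'h) \<Rightarrow> ('h \<Rightarrow> 'h) \<Rightarrow> 'h \<Rightarrow> 'h" where
  "op_mult V S T \<equiv> compose (hcarrier V) S T"

lemma op_mult_bounded:
  assumes S: "S \<in> bounded_operators (L2 N)" and T: "T \<in> bounded_operators (L2 N)"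
  shows "op_mult (L2 N) S T \<in> bounded_operators (L2 N)"
proof -
  obtain C where C: "0 \<le> C" "\<And>\<xi>. \<xi> \<in> hcarrier (L2 N) \<Longrightarrow> hnorm (L2 N) (S \<xi>) \<le> C * hnorm (L2 N) \<xi>"
    using bounded_op_bound[OF S] by metis
  obtain D where D: "\<And>\<xi>. \<xi> \<in> hcarrier (L2 N) \<Longrightarrow> hnorm (L2 N) (T \<xi>) \<le> D * hnorm (L2 N) \<xi>"
    using bounded_op_bound[OF T] by metis
  have "hnorm (L2 N) (S (T \<xi>)) \<le> (C * D) * hnorm (L2 N) \<xi>" if x: "\<xi> \<in> hcarrier (L2 N)" for \<xi>
    using C(2)[OF bounded_op_carrier[OF T x]] mult_left_mono[OF D[OF x] C(1)] by (simp add: mult.assoc)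
  moreover have "op_mult (L2 N) S T \<in> hcarrier (L2 N) \<rightarrow>\<^sub>E hcarrier (L2 N)"
    by (auto simp: compose_def bounded_op_carrier[OF S] bounded_op_carrier[OF T])
  ultimately show ?thesis
    unfolding bounded_operators_def
    by (auto simp: compose_eq hadd_carrier hscale_carrier bounded_op_add[OF S] bounded_op_add[OF T]
        bounded_op_scale[OF S] bounded_op_scale[OF T] bounded_op_carrier[OF S] bounded_op_carrier[OF T]
        intro!: exI[of _ "C * D"])
qed

lemma op_add_bounded:
  assumes S: "S \<in> bounded_operators (L2 N)" and T: "T \<in> bounded_operators (L2 N)"
  shows "op_add (L2 N) S T \<in> bounded_operators (L2 N)"
proof -
  obtain C where C: "0 \<le> C" "\<And>\<xi>. \<xi> \<in> hcarrier (L2 N) \<Longrightarrow> hnorm (L2 N) (S \<xi>) \<le> C * hnorm (L2 N) \<xi>"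
    using bounded_op_bound[OF S] by metis
  obtain D where D: "0 \<le> D" "\<And>\<xi>. \<xi> \<in> hcarrier (L2 N) \<Longrightarrow> hnorm (L2 N) (T \<xi>) \<le> D * hnorm (L2 N) \<xi>"
    using bounded_op_bound[OF T] by metis
  \<comment> \<open>The constant fits the inequality \<open>hnorm_add_sq\<close>, which replaces the
    triangle inequality: 2 C^2 + 2 D^2 is at most (2 (C + D))^2.\<close>
  let ?K = "2 * (C + D)"
  have b: "hnorm (L2 N) (hadd (L2 N) (S \<xi>) (T \<xi>)) \<le> ?K * hnorm (L2 N) \<xi>" if x: "\<xi> \<in> hcarrier (L2 N)" for \<xi>
  proof (rule power2_le_imp_le)
    let ?n = "hnorm (L2 N) \<xi>"
    have n: "0 \<le> ?n" using x by (rule hnorm_nonneg)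
    have "(hnorm (L2 N) (hadd (L2 N) (S \<xi>) (T \<xi>)))\<^sup>2 \<le> 2 * (hnorm (L2 N) (S \<xi>))\<^sup>2 + 2 * (hnorm (L2 N) (T \<xi>))\<^sup>2"
      using x by (intro hnorm_add_sq bounded_op_carrier[OF S] bounded_op_carrier[OF T])
    also have "\<dots> \<le> 2 * (C * ?n)\<^sup>2 + 2 * (D * ?n)\<^sup>2"
      using x C D by (intro add_mono mult_left_mono power_mono hnorm_nonneg bounded_op_carrier[OF S] bounded_op_carrier[OF T]) auto
    also have "\<dots> = (2 * C\<^sup>2 + 2 * D\<^sup>2) * ?n\<^sup>2" by (simp add: power_mult_distrib algebra_simps)
    also have "\<dots> \<le> ?K\<^sup>2 * ?n\<^sup>2"
      using C(1) D(1) by (intro mult_right_mono) (auto simp: power2_eq_square algebra_simps)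
    finally show "(hnorm (L2 N) (hadd (L2 N) (S \<xi>) (T \<xi>)))\<^sup>2 \<le> (?K * ?n)\<^sup>2"
      by (simp add: power_mult_distrib)
    show "0 \<le> ?K * ?n" using n C(1) D(1) by simp
  qed
  show ?thesis
    unfolding bounded_operators_def op_add_def
    using b
    by (auto simp: hadd_carrier hscale_carrier bounded_op_add[OF S] bounded_op_add[OF T]
        bounded_op_scale[OF S] bounded_op_scale[OF T] bounded_op_carrier[OF S] bounded_op_carrier[OF T]
        hadd_interchange hscale_hadd
        intro!: exI[of _ ?K])
qed

lemma commutantI:
  assumes "T \<in> bounded_operators V" "\<And>A \<xi>. A \<in> S \<Longrightarrow> \<xi> \<in> hcarrier V \<Longrightarrow> T (A \<xi>) = A (T \<xi>)"
  shows "T \<in> commutant V S"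
  using assms by (auto simp: commutant_def)

lemma commutantD:
  assumes "T \<in> commutant V S"
  shows "T \<in> bounded_operators V" "A \<in> S \<Longrightarrow> \<xi> \<in> hcarrier V \<Longrightarrow> T (A \<xi>) = A (T \<xi>)"
  using assms by (auto simp: commutant_def)

lemma commutant_mono: "S \<subseteq> S' \<Longrightarrow> commutant V S' \<subseteq> commutant V S"
  by (auto simp: commutant_def)

lemma commutant_commutant_incl: "S \<subseteq> bounded_operators V \<Longrightarrow> S \<subseteq> commutant V (commutant V S)"
  by (auto simp: commutant_def)

lemma commutant_op_mult:
  assumes "S \<subseteq> bounded_operators (L2 N)" "A \<in> commutant (L2 N) S" "B \<in> commutant (L2 N) S"
  shows "op_mult (L2 N) A B \<in> commutant (L2 N) S"
proof (rule commutantI)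
  show "op_mult (L2 N) A B \<in> bounded_operators (L2 N)"
    using assms by (intro op_mult_bounded commutantD)
  fix T \<xi> assume "T \<in> S" "\<xi> \<in> hcarrier (L2 N)"
  then show "op_mult (L2 N) A B (T \<xi>) = T (op_mult (L2 N) A B \<xi>)"
    using assms commutantD[OF assms(2)] commutantD[OF assms(3)]
    by (auto simp: compose_eq bounded_op_carrier subset_iff)
qed

lemma commutant_op_add:
  assumes "S \<subseteq> bounded_operators (L2 N)" "A \<in> commutant (L2 N) S" "B \<in> commutant (L2 N) S"
  shows "op_add (L2 N) A B \<in> commutant (L2 N) S"
proof (rule commutantI)
  show "op_add (L2 N) A B \<in> bounded_operators (L2 N)"
    using assms by (intro op_add_bounded commutantD)
  fix T \<xi> assume "T \<in> S" "\<xi> \<in> hcarrier (L2 N)"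
  then show "op_add (L2 N) A B (T \<xi>) = T (op_add (L2 N) A B \<xi>)"
    using assms commutantD[OF assms(2)] commutantD[OF assms(3)]
    by (auto simp: op_add_def bounded_op_carrier bounded_op_add subset_iff)
qed

lemma is_adjoint_unique:
  assumes "is_adjoint (L2 N) T S" "is_adjoint (L2 N) T S'"
    and b: "S \<in> bounded_operators (L2 N)" "S' \<in> bounded_operators (L2 N)"
  shows "S = S'"
proof (rule bounded_op_eqI[OF b], rule L2_eqI_inner)
  fix \<xi> c assume x: "\<xi> \<in> hcarrier (L2 N)" and c: "c \<in> hcarrier (L2 N)"
  have "hinner (L2 N) c (S \<xi>) = hinner (L2 N) c (S' \<xi>)"
    using assms(1,2) x c unfolding is_adjoint_def by metis
  then show "hinner (L2 N) (S \<xi>) c = hinner (L2 N) (S' \<xi>) c"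
    using hinner_sym[OF c bounded_op_carrier[OF b(1) x]] hinner_sym[OF c bounded_op_carrier[OF b(2) x]] by simp
qed (use b in \<open>auto intro: bounded_op_carrier\<close>)

lemma is_adjoint_sym:
  assumes "is_adjoint (L2 N) T S" "T \<in> bounded_operators (L2 N)" "S \<in> bounded_operators (L2 N)"
  shows "is_adjoint (L2 N) S T"
  unfolding is_adjoint_def
proof (intro ballI)
  fix \<xi> \<eta> assume x: "\<xi> \<in> hcarrier (L2 N)" and y: "\<eta> \<in> hcarrier (L2 N)"
  show "hinner (L2 N) (S \<xi>) \<eta> = hinner (L2 N) \<xi> (T \<eta>)"
    using assms(1) x y hinner_sym[OF y bounded_op_carrier[OF assms(3) x]]
      hinner_sym[OF bounded_op_carrier[OF assms(2) y] x]
    unfolding is_adjoint_def by simp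
qed

lemma is_adjoint_op_mult:
  assumes "is_adjoint (L2 N) A A'" "is_adjoint (L2 N) B B'"
    and "A \<in> bounded_operators (L2 N)" "B \<in> bounded_operators (L2 N)"
    and "A' \<in> bounded_operators (L2 N)" "B' \<in> bounded_operators (L2 N)"
  shows "is_adjoint (L2 N) (op_mult (L2 N) A B) (op_mult (L2 N) B' A')"
  using assms unfolding is_adjoint_def by (auto simp: compose_eq bounded_op_carrier)

lemma is_adjoint_op_add:
  assumes "is_adjoint (L2 N) A A'" "is_adjoint (L2 N) B B'"
    and "A \<in> bounded_operators (L2 N)" "B \<in> bounded_operators (L2 N)"
    and "A' \<in> bounded_operators (L2 N)" "B' \<in> bounded_operators (L2 N)"
  shows "is_adjoint (L2 N) (op_add (L2 N) A B) (op_add (L2 N) A' B')"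
  using assms unfolding is_adjoint_def
  by (auto simp: op_add_def bounded_op_carrier hinner_add_left hinner_add_right)

section \<open>Weighted composition operators\<close>

text \<open>Common form of the multiplications by functions, the group unitaries and the right
  multiplications; one proof of boundedness then serves all three.\<close>

definition wc_op ::
    "'a measure \<Rightarrow> ('a \<Rightarrow> complex) \<Rightarrow> ('a \<Rightarrow> 'a) \<Rightarrow> ('a \<Rightarrow> complex) set \<Rightarrow> ('a \<Rightarrow> complex) set" where
  "wc_op N w \<tau> = (\<lambda>\<xi>\<in>hcarrier (L2 N). L2_class N (\<lambda>z. w z * L2_rep \<xi> (\<tau> z)))"

definition mpt :: "'a measure \<Rightarrow> ('a \<Rightarrow> 'a) \<Rightarrow> bool" where
  "mpt N \<tau> \<longleftrightarrow> \<tau> \<in> measurable N N \<and> distr N N \<tau> = N"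

lemma mpt_ident: "mpt N (\<lambda>z. z)"
  using distr_id[of N] by (simp add: mpt_def id_def)

lemma mpt_AE: "mpt N \<tau> \<Longrightarrow> AE z in N. Q z \<Longrightarrow> AE z in N. Q (\<tau> z)"
  unfolding mpt_def using AE_distrD[of \<tau> N N Q] by metis

lemma mpt_integral:
  fixes f :: "'a \<Rightarrow> 'b::{banach, second_countable_topology}"
  assumes "mpt N \<tau>" "f \<in> borel_measurable N"
  shows "(\<integral>z. f (\<tau> z) \<partial>N) = (\<integral>z. f z \<partial>N)" "integrable N (\<lambda>z. f (\<tau> z)) \<longleftrightarrow> integrable N f"
  using assms integral_distr[of \<tau> N N f] integrable_distr_eq[of \<tau> N N f] by (auto simp: mpt_def)

lemma sq_integrable_comp:
  assumes t: "mpt N \<tau>" and f: "sq_integrable N f"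
  shows "sq_integrable N (\<lambda>z. f (\<tau> z))"
proof -
  have [measurable]: "\<tau> \<in> measurable N N" "f \<in> borel_measurable N"
    using t f by (auto simp: mpt_def sq_integrable_def)
  have "(\<lambda>z. (cmod (f z))\<^sup>2) \<in> borel_measurable N" by measurable
  from mpt_integral(2)[OF t this] have "integrable N (\<lambda>z. (cmod (f (\<tau> z)))\<^sup>2)"
    using sq_integrable_int[OF f] by simp
  then show ?thesis by (simp add: sq_integrable_def)
qed

lemma wc_sq:
  assumes w: "ess_bounded N w" and t: "mpt N \<tau>" and f: "sq_integrable N f"
  shows "sq_integrable N (\<lambda>z. w z * f (\<tau> z))"
proof -
  obtain C where [measurable]: "w \<in> borel_measurable N" and C: "AE z in N. cmod (w z) \<le> C"
    using w by (auto simp: ess_bounded_def)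
  have [measurable]: "\<tau> \<in> measurable N N" "f \<in> borel_measurable N"
    using t f by (auto simp: mpt_def sq_integrable_def)
  show ?thesis
  proof (rule sq_integrable_bound[OF sq_integrable_comp[OF t f], where c = C])
    show "AE z in N. cmod (w z * f (\<tau> z)) \<le> C * cmod (f (\<tau> z))"
      using C by eventually_elim (simp add: norm_mult mult_right_mono)
  qed measurable
qed

text \<open>The operator is defined through a chosen representative. Since the map preserves the
  measure, the null set on which two representatives differ is pulled back to a null set, so any
  representative may be used.\<close>

lemma wc_class:
  assumes w: "ess_bounded N w" and t: "mpt N \<tau>" and f: "sq_integrable N f"
  shows "wc_op N w \<tau> (L2_class N f) = L2_class N (\<lambda>z. w z * f (\<tau> z))"
proof -
  have "AE z in N. L2_rep (L2_class N f) (\<tau> z) = f (\<tau> z)"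
    by (rule mpt_AE[OF t L2_rep_class[OF f]])
  then have "AE z in N. w z * L2_rep (L2_class N f) (\<tau> z) = w z * f (\<tau> z)"
    by eventually_elim simp
  then have "L2_class N (\<lambda>z. w z * L2_rep (L2_class N f) (\<tau> z)) = L2_class N (\<lambda>z. w z * f (\<tau> z))"
    using f by (intro L2_class_cong wc_sq[OF w t] L2_rep_mem(1) L2_class_carrier)
  then show ?thesis
    unfolding wc_op_def using f by simp
qed

lemma wc_bounded:
  assumes w: "ess_bounded N w" and t: "mpt N \<tau>"
  shows "wc_op N w \<tau> \<in> bounded_operators (L2 N)"
proof -
  obtain C where [measurable]: "w \<in> borel_measurable N" and C': "AE z in N. cmod (w z) \<le> C"
    using w by (auto simp: ess_bounded_def)
  have C: "AE z in N. cmod (w z) \<le> \<bar>C\<bar>" using C' by eventually_elim simp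
  note cl = wc_class[OF w t] and sq = wc_sq[OF w t]
  have b1: "wc_op N w \<tau> \<in> hcarrier (L2 N) \<rightarrow>\<^sub>E hcarrier (L2 N)"
    by (auto simp: wc_op_def intro!: sq L2_rep_mem(1))
  have b2: "wc_op N w \<tau> (hadd (L2 N) \<xi> \<eta>) = hadd (L2 N) (wc_op N w \<tau> \<xi>) (wc_op N w \<tau> \<eta>)"
    if "\<xi> \<in> hcarrier (L2 N)" "\<eta> \<in> hcarrier (L2 N)" for \<xi> \<eta>
    using that by (elim L2_cases) (simp add: hadd_class cl sq sq_integrable_add distrib_left)
  have b3: "wc_op N w \<tau> (hscale (L2 N) c \<xi>) = hscale (L2 N) c (wc_op N w \<tau> \<xi>)"
    if "\<xi> \<in> hcarrier (L2 N)" for c \<xi>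
    using that by (elim L2_cases) (simp add: hscale_class cl sq sq_integrable_scale mult.left_commute)
  have b4: "hnorm (L2 N) (wc_op N w \<tau> \<xi>) \<le> \<bar>C\<bar> * hnorm (L2 N) \<xi>" if x: "\<xi> \<in> hcarrier (L2 N)" for \<xi>
  proof -
    obtain f where f: "sq_integrable N f" "\<xi> = L2_class N f" using x by (metis L2_cases)
    have [measurable]: "f \<in> borel_measurable N" using f by (simp add: sq_integrable_def)
    have "(\<integral>z. (cmod (w z * f (\<tau> z)))\<^sup>2 \<partial>N) \<le> (\<integral>z. \<bar>C\<bar>\<^sup>2 * (cmod (f (\<tau> z)))\<^sup>2 \<partial>N)"
    proof (rule integral_mono_AE)
      show "integrable N (\<lambda>z. (cmod (w z * f (\<tau> z)))\<^sup>2)" by (intro sq_integrable_int sq f)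
      show "integrable N (\<lambda>z. \<bar>C\<bar>\<^sup>2 * (cmod (f (\<tau> z)))\<^sup>2)"
        using sq_integrable_int[OF sq_integrable_comp[OF t f(1)]] by simp
      show "AE z in N. (cmod (w z * f (\<tau> z)))\<^sup>2 \<le> \<bar>C\<bar>\<^sup>2 * (cmod (f (\<tau> z)))\<^sup>2"
        using C
      proof eventually_elim
        case (elim z)
        show ?case unfolding norm_mult power_mult_distrib
          by (intro mult_right_mono power_mono elim) auto
      qed
    qed
    also have "\<dots> = \<bar>C\<bar>\<^sup>2 * (\<integral>z. (cmod (f (\<tau> z)))\<^sup>2 \<partial>N)" by simp
    also have "(\<integral>z. (cmod (f (\<tau> z)))\<^sup>2 \<partial>N) = (\<integral>z. (cmod (f z))\<^sup>2 \<partial>N)"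
      by (rule mpt_integral(1)[OF t, of "\<lambda>z. (cmod (f z))\<^sup>2"]) measurable
    finally have "sqrt (\<integral>z. (cmod (w z * f (\<tau> z)))\<^sup>2 \<partial>N) \<le> sqrt (\<bar>C\<bar>\<^sup>2 * (\<integral>z. (cmod (f z))\<^sup>2 \<partial>N))"
      by (rule real_sqrt_le_mono)
    then show ?thesis
      using f by (simp add: cl hnorm_class sq real_sqrt_mult)
  qed
  show ?thesis
    unfolding bounded_operators_def
    by (intro CollectI conjI allI ballI exI[of _ "\<bar>C\<bar>"] b1 b2 b3 b4)
qed

lemma ess_boundedI:
  "w \<in> borel_measurable N \<Longrightarrow> (\<And>z. z \<in> space N \<Longrightarrow> cmod (w z) \<le> C) \<Longrightarrow> ess_bounded N w"
  by (auto simp: ess_bounded_def intro!: exI[of _ C] AE_I2)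

section \<open>Left and right multiplication operators\<close>

locale pmp_system = group G for G :: "('g, 'm) monoid_scheme" (structure) +
  fixes M :: "'x measure" and \<sigma> :: "'g \<Rightarrow> 'x \<Rightarrow> 'x"
  assumes countable_G: "countable (carrier G)"
    and infinite_G: "infinite (carrier G)"
    and prob_M: "prob_space M"
    and pmp: "pmp_action G M \<sigma>"
begin

sublocale prob_space M by (rule prob_M)

sublocale action: group_action G "space M" \<sigma>
  using pmp by (simp add: pmp_action_def)

sublocale counting: sigma_finite_measure "count_space (carrier G)"
  by (rule sigma_finite_measure_count_space_countable[OF countable_G])

sublocale pair_sigma_finite M "count_space (carrier G)" ..

abbreviation N where "N \<equiv> XG_measure G M"

lemma \<sigma>_meas [measurable]: "g \<in> carrier G \<Longrightarrow> \<sigma> g \<in> measurable M M"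
  using pmp by (simp add: pmp_action_def)

lemma \<sigma>_mpt: "g \<in> carrier G \<Longrightarrow> mpt M (\<sigma> g)"
  using pmp by (simp add: pmp_action_def mpt_def)

lemma \<sigma>_space [simp, intro]: "g \<in> carrier G \<Longrightarrow> x \<in> space M \<Longrightarrow> \<sigma> g x \<in> space M"
  using measurable_space[OF \<sigma>_meas] .

lemma \<sigma>_\<sigma> [simp]: "g \<in> carrier G \<Longrightarrow> h \<in> carrier G \<Longrightarrow> x \<in> space M \<Longrightarrow> \<sigma> g (\<sigma> h x) = \<sigma> (g \<otimes> h) x"
  by (simp add: action.composition_rule)

lemma \<sigma>_one [simp]: "x \<in> space M \<Longrightarrow> \<sigma> \<one> x = x"
  using action.id_eq_one by (metis restrict_apply')

text \<open>Countability of G makes X x G a countable union of slices, so measurability can be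
  tested on each slice.\<close>

lemma meas_N:
  assumes "\<And>k. k \<in> carrier G \<Longrightarrow> (\<lambda>x. f (x, k)) \<in> measurable M K"
  shows "f \<in> measurable N K"
proof -
  have "(\<lambda>(k, x). f (x, k)) \<in> measurable (count_space (carrier G) \<Otimes>\<^sub>M M) K"
    using assms by (intro measurable_pair_measure_countable1 countable_G) auto
  from measurable_compose[OF measurable_pair_swap' this]
  show ?thesis by (simp add: split_beta')
qed

lemma meas_slice [measurable (raw)]:
  assumes "f \<in> measurable N K" "k \<in> carrier G"
  shows "(\<lambda>x. f (x, k)) \<in> measurable M K"
  by (rule measurable_compose[OF _ assms(1)]) (use assms(2) in \<open>auto intro!: measurable_Pair measurable_const\<close>)

lemma sets_slice: "A \<in> sets N \<Longrightarrow> (\<lambda>x. (x, k)) -` A \<in> sets M"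
  by (rule sets_Pair2)

text \<open>For the converse, the exceptional sets of countably many slices fit into one null set
  \<open>Z\<close>, and \<open>Z \<times> carrier G\<close> is again null.\<close>

lemma AE_N_iff: "(AE z in N. Q z) \<longleftrightarrow> (\<forall>k\<in>carrier G. AE x in M. Q (x, k))"
proof
  assume "AE z in N. Q z"
  then have "AE x in M. \<forall>k\<in>carrier G. Q (x, k)"
    using AE_pair[of Q] by (simp add: AE_count_space)
  then show "\<forall>k\<in>carrier G. AE x in M. Q (x, k)"
    by (auto elim!: eventually_mono)
next
  assume "\<forall>k\<in>carrier G. AE x in M. Q (x, k)"
  then have "AE x in M. \<forall>k\<in>carrier G. Q (x, k)"
    by (simp add: AE_ball_countable[OF countable_G])
  then obtain Z where Z: "{x \<in> space M. \<not> (\<forall>k\<in>carrier G. Q (x, k))} \<subseteq> Z" "emeasure M Z = 0" "Z \<in> sets M"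
    by (rule AE_E)
  have "Z \<times> carrier G \<in> null_sets N"
    using Z counting.emeasure_pair_measure_Times[of Z M "carrier G"] by (auto simp: null_sets_def)
  then show "AE z in N. Q z"
    by (rule AE_I') (use Z(1) in \<open>auto simp: space_pair_measure\<close>)
qed

text \<open>The slices are permuted by \<rho>, and each is moved by a measure preserving map of its
  own; the measure of a set is the sum over its slices. Left translations, right translations and
  \<open>flip\<close> all have this shape.\<close>

lemma mpt_N:
  assumes \<pi>: "\<And>k. k \<in> carrier G \<Longrightarrow> \<pi> k \<in> carrier G" and \<rho>: "bij_betw \<rho> (carrier G) (carrier G)"
  shows "mpt N (\<lambda>z. (\<sigma> (\<pi> (snd z)) (fst z), \<rho> (snd z)))"
proof -
  let ?t = "\<lambda>z. (\<sigma> (\<pi> (snd z)) (fst z), \<rho> (snd z))"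
  have \<rho>c: "\<rho> k \<in> carrier G" if "k \<in> carrier G" for k using \<rho> that by (auto simp: bij_betw_def)
  have t: "?t \<in> measurable N N"
    by (rule meas_N) (auto intro!: measurable_Pair measurable_const \<sigma>_meas \<pi> \<rho>c)
  have "distr N N ?t = N"
  proof (rule measure_eqI)
    fix A assume "A \<in> sets (distr N N ?t)"
    then have A: "A \<in> sets N" by simp
    have slice: "emeasure M ((\<lambda>x. (x, k)) -` (?t -` A \<inter> space N)) = emeasure M ((\<lambda>x. (x, \<rho> k)) -` A)"
      if k: "k \<in> carrier G" for k
    proof -
      have "(\<lambda>x. (x, k)) -` (?t -` A \<inter> space N) = \<sigma> (\<pi> k) -` ((\<lambda>x. (x, \<rho> k)) -` A) \<inter> space M"
        using k by (auto simp: space_pair_measure)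
      also have "emeasure M \<dots> = emeasure (distr M M (\<sigma> (\<pi> k))) ((\<lambda>x. (x, \<rho> k)) -` A)"
        using sets_slice[OF A] \<pi>[OF k] by (subst emeasure_distr) auto
      also have "distr M M (\<sigma> (\<pi> k)) = M" using \<sigma>_mpt[OF \<pi>[OF k]] by (simp add: mpt_def)
      finally show ?thesis .
    qed
    have "emeasure (distr N N ?t) A = emeasure N (?t -` A \<inter> space N)"
      using t A by (rule emeasure_distr)
    also have "\<dots> = (\<integral>\<^sup>+k. emeasure M ((\<lambda>x. (x, k)) -` (?t -` A \<inter> space N)) \<partial>count_space (carrier G))"
      using t A by (intro emeasure_pair_measure_alt2 measurable_sets)
    also have "\<dots> = (\<integral>\<^sup>+k. emeasure M ((\<lambda>x. (x, \<rho> k)) -` A) \<partial>count_space (carrier G))"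
      by (rule nn_integral_cong, rule slice) simp
    also have "\<dots> = (\<integral>\<^sup>+k. emeasure M ((\<lambda>x. (x, k)) -` A) \<partial>count_space (carrier G))"
      by (rule nn_integral_bij_count_space[OF \<rho>])
    also have "\<dots> = emeasure N A" using A by (rule emeasure_pair_measure_alt2[symmetric])
    finally show "emeasure (distr N N ?t) A = emeasure N A" .
  qed simp
  with t show ?thesis by (simp add: mpt_def)
qed

text \<open>With a slice written as a density of \<open>N\<close>, integrals of Banach-valued
  functions over a slice follow from the rules for image measures and densities.\<close>

lemma distr_slice:
  assumes k: "k \<in> carrier G"
  shows "distr M N (\<lambda>x. (x, k)) = density N (\<lambda>z. indicator {k} (snd z))"
proof (rule measure_eqI)
  fix A assume "A \<in> sets (distr M N (\<lambda>x. (x, k)))"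
  then have A [measurable]: "A \<in> sets N" by simp
  have sl: "(\<lambda>x. (x, k)) \<in> measurable M N" using k by measurable
  have ind: "(\<lambda>z. indicator {k} (snd z) :: ennreal) \<in> borel_measurable N"
    by (rule meas_N) simp
  then have ind': "(\<lambda>z. indicator {k} (snd z) * indicator A z :: ennreal) \<in> borel_measurable N"
    by measurable
  have "emeasure (density N (\<lambda>z. indicator {k} (snd z))) A = (\<integral>\<^sup>+z. indicator {k} (snd z) * indicator A z \<partial>N)"
    using ind by (rule emeasure_density) measurable
  also have "\<dots> = (\<integral>\<^sup>+j. (\<integral>\<^sup>+x. indicator {k} j * indicator A (x, j) \<partial>M) \<partial>count_space (carrier G))"
    using nn_integral_snd[OF ind'] by simp
  also have "\<dots> = (\<integral>\<^sup>+j. emeasure M ((\<lambda>x. (x, j)) -` A) * indicator {k} j \<partial>count_space (carrier G))"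
  proof (rule nn_integral_cong)
    fix j
    have "(\<integral>\<^sup>+x. indicator A (x, j) \<partial>M) = (\<integral>\<^sup>+x. indicator ((\<lambda>x. (x, j)) -` A) x \<partial>M)"
      by (rule nn_integral_cong) (auto simp: indicator_def)
    also have "\<dots> = emeasure M ((\<lambda>x. (x, j)) -` A)"
      using sets_slice[OF A] by simp
    finally show "(\<integral>\<^sup>+x. indicator {k} j * indicator A (x, j) \<partial>M) = emeasure M ((\<lambda>x. (x, j)) -` A) * indicator {k} j"
      by (auto simp: indicator_def)
  qed
  also have "\<dots> = emeasure M ((\<lambda>x. (x, k)) -` A)"
    using k by (subst nn_integral_indicator_singleton) auto
  also have "\<dots> = emeasure (distr M N (\<lambda>x. (x, k))) A"
    using sl A sets.sets_into_space[OF A]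
    by (subst emeasure_distr) (auto intro!: arg_cong[of _ _ "emeasure M"] simp: space_pair_measure)
  finally show "emeasure (distr M N (\<lambda>x. (x, k))) A = emeasure (density N (\<lambda>z. indicator {k} (snd z))) A" ..
qed simp

lemma integral_slice:
  fixes f :: "'x \<times> 'g \<Rightarrow> 'b::{banach, second_countable_topology}"
  assumes f [measurable]: "f \<in> borel_measurable N" and k: "k \<in> carrier G"
    and supp: "\<And>x j. x \<in> space M \<Longrightarrow> j \<in> carrier G \<Longrightarrow> j \<noteq> k \<Longrightarrow> f (x, j) = 0"
  shows "(\<integral>z. f z \<partial>N) = (\<integral>x. f (x, k) \<partial>M)" "integrable N f \<longleftrightarrow> integrable M (\<lambda>x. f (x, k))"
proof -
  have sl: "(\<lambda>x. (x, k)) \<in> measurable M N" using k by measurable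
  have ind: "(\<lambda>z. indicator {k} (snd z) :: real) \<in> borel_measurable N"
    by (rule meas_N) simp
  have den: "distr M N (\<lambda>x. (x, k)) = density N (\<lambda>z. ennreal (indicator {k} (snd z)))"
    unfolding distr_slice[OF k] by (simp add: ennreal_indicator)
  have eq: "indicator {k} (snd z) *\<^sub>R f z = f z" if "z \<in> space N" for z
    using that supp[of "fst z" "snd z"] by (auto simp: indicator_def space_pair_measure)
  have "(\<integral>x. f (x, k) \<partial>M) = (\<integral>z. f z \<partial>distr M N (\<lambda>x. (x, k)))"
    using sl f by (rule integral_distr[symmetric])
  also have "\<dots> = (\<integral>z. indicator {k} (snd z) *\<^sub>R f z \<partial>N)"
    unfolding den using ind by (intro integral_density) auto
  also have "\<dots> = (\<integral>z. f z \<partial>N)"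
    by (rule Bochner_Integration.integral_cong) (auto simp: eq)
  finally show "(\<integral>z. f z \<partial>N) = (\<integral>x. f (x, k) \<partial>M)" ..
  have "integrable M (\<lambda>x. f (x, k)) \<longleftrightarrow> integrable (distr M N (\<lambda>x. (x, k))) f"
    using sl f by (rule integrable_distr_eq[symmetric])
  also have "\<dots> \<longleftrightarrow> integrable N (\<lambda>z. indicator {k} (snd z) *\<^sub>R f z)"
    unfolding den using ind by (intro integrable_density) auto
  also have "\<dots> \<longleftrightarrow> integrable N f"
    by (rule Bochner_Integration.integrable_cong) (auto simp: eq)
  finally show "integrable N f \<longleftrightarrow> integrable M (\<lambda>x. f (x, k))" ..
qed

section \<open>Columns, left and right multiplications\<close>

definition col :: "'g \<Rightarrow> ('x \<Rightarrow> complex) \<Rightarrow> 'x \<times> 'g \<Rightarrow> complex" where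
  "col k b = (\<lambda>z. if snd z = k then b (fst z) else 0)"

lemma col_meas: "b \<in> borel_measurable M \<Longrightarrow> col k b \<in> borel_measurable N"
  by (rule meas_N) (simp add: col_def)

lemma sq_integrable_col:
  assumes "sq_integrable M b" "k \<in> carrier G"
  shows "sq_integrable N (col k b)"
proof -
  have m [measurable]: "b \<in> borel_measurable M" using assms by (simp add: sq_integrable_def)
  have [measurable]: "col k b \<in> borel_measurable N" by (rule col_meas[OF m])
  have "integrable N (\<lambda>z. (cmod (col k b z))\<^sup>2) \<longleftrightarrow> integrable M (\<lambda>x. (cmod (col k b (x, k)))\<^sup>2)"
    using assms(2) by (intro integral_slice) (measurable, auto simp: col_def)
  then show ?thesis
    using assms col_meas[OF m] by (simp add: sq_integrable_def col_def)
qed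

lemma sq_integrable_slice:
  assumes f: "sq_integrable N f" and k: "k \<in> carrier G"
  shows "sq_integrable M (\<lambda>x. f (x, k))"
proof -
  have m [measurable]: "f \<in> borel_measurable N" using f by (simp add: sq_integrable_def)
  have [measurable]: "(\<lambda>x. f (x, k)) \<in> borel_measurable M" using m k by (rule meas_slice)
  have c [measurable]: "col k (\<lambda>x. f (x, k)) \<in> borel_measurable N" by (rule col_meas) measurable
  have "sq_integrable N (col k (\<lambda>x. f (x, k)))"
    by (rule sq_integrable_bound[OF f c, where c = 1]) (auto simp: col_def)
  then have "integrable N (\<lambda>z. (cmod (col k (\<lambda>x. f (x, k)) z))\<^sup>2)" by (rule sq_integrable_int)
  then have "integrable M (\<lambda>x. (cmod (col k (\<lambda>x. f (x, k)) (x, k)))\<^sup>2)"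
    using k by (subst (asm) integral_slice(2)[of _ k]) (measurable, auto simp: col_def)
  then show ?thesis by (simp add: sq_integrable_def col_def)
qed

text \<open>The bound holds everywhere, not almost everywhere: the weight of \<open>right_op\<close>
  composes \<open>b\<close> with a different \<sigma> in each slice, and a pointwise bound passes to
  all of them at once.\<close>

definition bfun :: "('x \<Rightarrow> complex) \<Rightarrow> bool" where
  "bfun b \<longleftrightarrow> b \<in> borel_measurable M \<and> (\<exists>C. \<forall>x\<in>space M. cmod (b x) \<le> C)"

lemma bfun_meas: "bfun b \<Longrightarrow> b \<in> borel_measurable M"
  by (simp add: bfun_def)

lemma bfun_ess: "bfun b \<Longrightarrow> ess_bounded M b"
  by (auto simp: bfun_def intro: ess_boundedI)

lemma ess_sq:
  assumes "ess_bounded M b"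
  shows "sq_integrable M b"
proof -
  obtain C where m: "b \<in> borel_measurable M" and C: "AE z in M. cmod (b z) \<le> C"
    using assms by (auto simp: ess_bounded_def)
  have 1: "sq_integrable M (\<lambda>_. 1)" by (simp add: sq_integrable_def)
  show ?thesis
    by (rule sq_integrable_bound[OF 1 m, where c = C]) (use C in simp)
qed

lemma bfun_const [simp]: "bfun (\<lambda>_. c)" by (auto simp: bfun_def)

lemma bfun_indicator: "A \<in> sets M \<Longrightarrow> bfun (indicator A)"
  by (auto simp: bfun_def indicator_def intro!: exI[of _ 1])

lemma bfun_comp: "bfun b \<Longrightarrow> g \<in> carrier G \<Longrightarrow> bfun (\<lambda>x. b (\<sigma> g x))"
  unfolding bfun_def by (auto intro: measurable_compose[OF \<sigma>_meas])

text \<open>The vector \<open>b \<otimes> \<delta>\<^sub>k\<close>.\<close>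

definition cv :: "'g \<Rightarrow> ('x \<Rightarrow> complex) \<Rightarrow> ('x \<times> 'g \<Rightarrow> complex) set" where
  "cv k b = L2_class N (col k b)"

text \<open>The trace vector. For x in the crossed product, the slice at k of x \<Omega> is the
  Fourier coefficient of x at k; compare \<open>au_\<Omega>\<close>.\<close>

definition \<Omega> where "\<Omega> = cv \<one> (\<lambda>_. 1)"

lemma cv_carrier: "ess_bounded M b \<Longrightarrow> k \<in> carrier G \<Longrightarrow> cv k b \<in> hcarrier (L2 N)"
  unfolding cv_def by (intro L2_class_carrier sq_integrable_col ess_sq)

lemma \<Omega>_carrier [simp, intro]: "\<Omega> \<in> hcarrier (L2 N)"
  unfolding \<Omega>_def by (intro cv_carrier bfun_ess) auto

text \<open>The operator of right multiplication by \<open>b u\<^sub>h\<close>.\<close>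

definition right_op :: "'g \<Rightarrow> ('x \<Rightarrow> complex) \<Rightarrow> ('x \<times> 'g \<Rightarrow> complex) set \<Rightarrow> ('x \<times> 'g \<Rightarrow> complex) set" where
  "right_op h b = wc_op N (\<lambda>z. b (\<sigma> (h \<otimes> inv (snd z)) (fst z))) (\<lambda>z. (fst z, snd z \<otimes> inv h))"

lemma bij_right: "h \<in> carrier G \<Longrightarrow> bij_betw (\<lambda>k. k \<otimes> h) (carrier G) (carrier G)"
  by (rule bij_betwI[where g = "\<lambda>k. k \<otimes> inv h"]) (auto simp: m_assoc)

lemma bij_left: "h \<in> carrier G \<Longrightarrow> bij_betw (\<lambda>k. h \<otimes> k) (carrier G) (carrier G)"
  by (rule bij_betwI[where g = "\<lambda>k. inv h \<otimes> k"]) (auto simp: m_assoc[symmetric])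

lemma mpt_cong: "mpt K s \<Longrightarrow> (\<And>z. z \<in> space K \<Longrightarrow> t z = s z) \<Longrightarrow> mpt K t"
  unfolding mpt_def by (metis measurable_cong distr_cong)

lemma right_op_w: "bfun b \<Longrightarrow> h \<in> carrier G \<Longrightarrow> ess_bounded N (\<lambda>z. b (\<sigma> (h \<otimes> inv (snd z)) (fst z)))"
proof -
  assume b: "bfun b" and h: "h \<in> carrier G"
  then obtain C where C: "\<And>x. x \<in> space M \<Longrightarrow> cmod (b x) \<le> C" by (auto simp: bfun_def)
  show ?thesis
  proof (rule ess_boundedI)
    show "(\<lambda>z. b (\<sigma> (h \<otimes> inv (snd z)) (fst z))) \<in> borel_measurable N"
      using h bfun_meas[OF b] by (intro meas_N) (auto intro!: measurable_compose[OF \<sigma>_meas])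
    show "cmod (b (\<sigma> (h \<otimes> inv (snd z)) (fst z))) \<le> C" if "z \<in> space N" for z
      using that h by (intro C \<sigma>_space) (auto simp: space_pair_measure)
  qed
qed

lemma right_op_t: "h \<in> carrier G \<Longrightarrow> mpt N (\<lambda>z. (fst z, snd z \<otimes> inv h))"
  by (rule mpt_cong[OF mpt_N[where \<pi> = "\<lambda>_. \<one>" and \<rho> = "\<lambda>k. k \<otimes> inv h"]])
     (auto simp: space_pair_measure intro!: bij_right)

lemma right_op_bounded: "bfun b \<Longrightarrow> h \<in> carrier G \<Longrightarrow> right_op h b \<in> bounded_operators (L2 N)"
  unfolding right_op_def by (intro wc_bounded right_op_w right_op_t)

lemma right_op_class:
  "bfun b \<Longrightarrow> h \<in> carrier G \<Longrightarrow> sq_integrable N f \<Longrightarrow>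
    right_op h b (L2_class N f) = L2_class N (\<lambda>z. b (\<sigma> (h \<otimes> inv (snd z)) (fst z)) * f (fst z, snd z \<otimes> inv h))"
  unfolding right_op_def by (intro wc_class right_op_w right_op_t)

lemma right_op_sq:
  "bfun b \<Longrightarrow> h \<in> carrier G \<Longrightarrow> sq_integrable N f \<Longrightarrow>
    sq_integrable N (\<lambda>z. b (\<sigma> (h \<otimes> inv (snd z)) (fst z)) * f (fst z, snd z \<otimes> inv h))"
  by (intro wc_sq[OF right_op_w right_op_t, of b h h f]) 

text \<open>Algebraic rewriting in G and of \<sigma> is valid only at points of the space.
  Transferring square-integrability as well spares a separate measurability proof for the rewritten
  function.\<close>

lemma L2_class_cong_space:
  "sq_integrable N f \<Longrightarrow> (\<And>x k. x \<in> space M \<Longrightarrow> k \<in> carrier G \<Longrightarrow> f (x, k) = g (x, k)) \<Longrightarrow>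
    L2_class N f = L2_class N g \<and> sq_integrable N g"
proof -
  assume f: "sq_integrable N f" and eq: "\<And>x k. x \<in> space M \<Longrightarrow> k \<in> carrier G \<Longrightarrow> f (x, k) = g (x, k)"
  have eq': "f z = g z" if "z \<in> space N" for z
    using that eq[of "fst z" "snd z"] by (auto simp: space_pair_measure)
  have "g \<in> borel_measurable N"
    using f measurable_cong[of N f g borel, OF eq'] by (simp add: sq_integrable_def)
  moreover have "integrable N (\<lambda>z. (cmod (g z))\<^sup>2)"
    using sq_integrable_int[OF f] Bochner_Integration.integrable_cong[of N N "\<lambda>z. (cmod (f z))\<^sup>2" "\<lambda>z. (cmod (g z))\<^sup>2"] eq'
    by simp
  ultimately have g: "sq_integrable N g" by (simp add: sq_integrable_def)
  have "L2_class N f = L2_class N g"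
    by (rule L2_class_cong[OF f g AE_I2]) (rule eq')
  with g show ?thesis by simp
qed

text \<open>Every bounded column is a right translate of \<Omega>. Hence an operator that commutes
  with right multiplications is determined on bounded columns by its value at \<Omega>.\<close>

lemma right_op_\<Omega>:
  assumes b: "bfun b" and h: "h \<in> carrier G"
  shows "right_op h b \<Omega> = cv h b"
proof -
  have s: "sq_integrable N (col \<one> (\<lambda>_. 1))"
    by (intro sq_integrable_col ess_sq bfun_ess) auto
  show ?thesis
    unfolding \<Omega>_def cv_def right_op_class[OF b h s]
  proof (rule L2_class_cong_space[THEN conjunct1])
    fix x k assume x: "x \<in> space M" and k: "k \<in> carrier G"
    have "k \<otimes> inv h = \<one> \<longleftrightarrow> k = h"
      using h k by (metis inv_closed inv_equality inv_inv r_inv)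
    then show "b (\<sigma> (h \<otimes> inv snd (x, k)) (fst (x, k))) * col \<one> (\<lambda>_. 1) (fst (x, k), snd (x, k) \<otimes> inv h) = col h b (x, k)"
      using x h by (auto simp: col_def)
  qed (rule right_op_sq[OF b h s])
qed

lemma mult_op_eq: "mult_op G M a = wc_op N (\<lambda>z. a (fst z)) (\<lambda>z. z)"
  unfolding mult_op_def wc_op_def by (simp add: split_beta')

lemma group_op_eq:
  "group_op G M \<sigma> g = wc_op N (\<lambda>_. 1) (\<lambda>z. (\<sigma> (inv g) (fst z), inv g \<otimes> snd z))"
  unfolding group_op_def wc_op_def by (simp add: split_beta')

lemma mult_w: "ess_bounded M a \<Longrightarrow> ess_bounded N (\<lambda>z. a (fst z))"
  unfolding ess_bounded_def AE_N_iff by (auto intro!: measurable_compose[OF measurable_fst])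

lemma group_t: "g \<in> carrier G \<Longrightarrow> mpt N (\<lambda>z. (\<sigma> (inv g) (fst z), inv g \<otimes> snd z))"
  by (rule mpt_N[where \<pi> = "\<lambda>_. inv g" and \<rho> = "\<lambda>k. inv g \<otimes> k"]) (auto intro!: bij_left)

lemma one_w: "ess_bounded N (\<lambda>_. 1)" by (rule ess_boundedI[where C = 1]) auto

lemma mult_bounded: "ess_bounded M a \<Longrightarrow> mult_op G M a \<in> bounded_operators (L2 N)"
  unfolding mult_op_eq by (intro wc_bounded mult_w mpt_ident)

lemma group_bounded: "g \<in> carrier G \<Longrightarrow> group_op G M \<sigma> g \<in> bounded_operators (L2 N)"
  unfolding group_op_eq by (intro wc_bounded one_w group_t)

lemma mult_class:
  "ess_bounded M a \<Longrightarrow> sq_integrable N f \<Longrightarrow> mult_op G M a (L2_class N f) = L2_class N (\<lambda>z. a (fst z) * f z)"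
  unfolding mult_op_eq by (intro wc_class mult_w mpt_ident)

lemma mult_sq: "ess_bounded M a \<Longrightarrow> sq_integrable N f \<Longrightarrow> sq_integrable N (\<lambda>z. a (fst z) * f z)"
  by (intro wc_sq[OF mult_w mpt_ident, of a f])

lemma group_class:
  "g \<in> carrier G \<Longrightarrow> sq_integrable N f \<Longrightarrow>
    group_op G M \<sigma> g (L2_class N f) = L2_class N (\<lambda>z. f (\<sigma> (inv g) (fst z), inv g \<otimes> snd z))"
  unfolding group_op_eq using wc_class[OF one_w group_t, of g f] by simp

lemma group_sq:
  "g \<in> carrier G \<Longrightarrow> sq_integrable N f \<Longrightarrow> sq_integrable N (\<lambda>z. f (\<sigma> (inv g) (fst z), inv g \<otimes> snd z))"
  by (rule sq_integrable_comp[OF group_t])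

definition gens :: "'g set \<Rightarrow> (('x \<times> 'g \<Rightarrow> complex) set \<Rightarrow> ('x \<times> 'g \<Rightarrow> complex) set) set" where
  "gens K = mult_op G M ` {a. ess_bounded M a} \<union> group_op G M \<sigma> ` K"

lemma crossed_product_eq: "crossed_product G M \<sigma> K = commutant (L2 N) (commutant (L2 N) (gens K))"
  by (simp add: crossed_product_def gens_def)

lemma gens_bounded: "K \<subseteq> carrier G \<Longrightarrow> gens K \<subseteq> bounded_operators (L2 N)"
  by (auto simp: gens_def mult_bounded group_bounded)

definition right_ops where "right_ops = {right_op h b | h b. h \<in> carrier G \<and> bfun b}"

lemma right_ops_bounded: "right_ops \<subseteq> bounded_operators (L2 N)"
  by (auto simp: right_ops_def right_op_bounded)

text \<open>By the commutation theorem this is the crossed product by \<open>G\<close>; only one inclusion is used.\<close>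

definition right_commutant where "right_commutant = commutant (L2 N) right_ops"

lemma right_op_mult_commute:
  assumes "bfun b" "h \<in> carrier G" "ess_bounded M a" "\<xi> \<in> hcarrier (L2 N)"
  shows "right_op h b (mult_op G M a \<xi>) = mult_op G M a (right_op h b \<xi>)"
proof -
  obtain f where f: "sq_integrable N f" "\<xi> = L2_class N f" using assms(4) by (metis L2_cases)
  show ?thesis
    unfolding f(2) using assms f(1)
    by (simp add: mult_class right_op_class mult_sq right_op_sq mult.left_commute)
qed

lemma right_op_group_commute:
  assumes b: "bfun b" and h: "h \<in> carrier G" and g: "g \<in> carrier G" and x: "\<xi> \<in> hcarrier (L2 N)"
  shows "right_op h b (group_op G M \<sigma> g \<xi>) = group_op G M \<sigma> g (right_op h b \<xi>)"
proof -
  obtain f where f: "sq_integrable N f" "\<xi> = L2_class N f" using x by (metis L2_cases)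
  note s = right_op_sq[OF b h group_sq[OF g f(1)]]
  have "right_op h b (group_op G M \<sigma> g \<xi>)
     = L2_class N (\<lambda>z. b (\<sigma> (h \<otimes> inv (snd z)) (fst z)) * f (\<sigma> (inv g) (fst z), inv g \<otimes> (snd z \<otimes> inv h)))"
    unfolding f(2) using right_op_class[OF b h group_sq[OF g f(1)]] by (simp add: group_class[OF g f(1)])
  \<comment> \<open>Left translation replaces x by g^-1 x and k by g^-1 k. In the weight the two
    changes cancel, as h (g^-1 k)^-1 g^-1 = h k^-1.\<close>
  also have "\<dots> = L2_class N (\<lambda>z. b (\<sigma> (h \<otimes> inv (inv g \<otimes> snd z)) (\<sigma> (inv g) (fst z)))
      * f (\<sigma> (inv g) (fst z), inv g \<otimes> snd z \<otimes> inv h))"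
    by (rule L2_class_cong_space[THEN conjunct1])
       (use s g h in \<open>auto simp: m_assoc inv_mult_group\<close>)
  also have "\<dots> = group_op G M \<sigma> g (right_op h b \<xi>)"
    unfolding f(2) right_op_class[OF b h f(1)] using group_class[OF g right_op_sq[OF b h f(1)]] by simp
  finally show ?thesis .
qed

lemma gens_right_commutant: "K \<subseteq> carrier G \<Longrightarrow> gens K \<subseteq> right_commutant"
  unfolding right_commutant_def right_ops_def gens_def
  by (auto intro!: commutantI mult_bounded group_bounded simp: right_op_mult_commute right_op_group_commute subset_iff)

lemma mult_right_commutant: "ess_bounded M a \<Longrightarrow> mult_op G M a \<in> right_commutant"
  using gens_right_commutant[of "carrier G"] by (auto simp: gens_def)

lemma group_right_commutant: "g \<in> carrier G \<Longrightarrow> group_op G M \<sigma> g \<in> right_commutant"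
  using gens_right_commutant[of "carrier G"] by (auto simp: gens_def)

text \<open>The right multiplications lie in the commutant of the generators; taking commutants once
  more reverses the inclusion.\<close>

lemma crossed_product_right_commutant: "crossed_product G M \<sigma> (carrier G) \<subseteq> right_commutant"
proof -
  have "right_ops \<subseteq> commutant (L2 N) (gens (carrier G))"
    unfolding right_ops_def gens_def
    by (auto intro!: commutantI right_op_bounded simp: right_op_mult_commute right_op_group_commute)
  then show ?thesis
    unfolding crossed_product_eq right_commutant_def by (rule commutant_mono)
qed

lemma right_commutant_bounded: "x \<in> right_commutant \<Longrightarrow> x \<in> bounded_operators (L2 N)"
  unfolding right_commutant_def by (rule commutantD)

lemma right_commutant_R: "x \<in> right_commutant \<Longrightarrow> bfun b \<Longrightarrow> h \<in> carrier G \<Longrightarrow> \<xi> \<in> hcarrier (L2 N) \<Longrightarrow> x (right_op h b \<xi>) = right_op h b (x \<xi>)"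
  unfolding right_commutant_def right_ops_def by (auto simp: commutant_def)

lemma right_commutant_cv: "x \<in> right_commutant \<Longrightarrow> bfun b \<Longrightarrow> h \<in> carrier G \<Longrightarrow> x (cv h b) = right_op h b (x \<Omega>)"
  using right_commutant_R[of x b h \<Omega>] by (simp add: right_op_\<Omega>)

subsection \<open>Totality of the bounded columns\<close>

text \<open>Large values are sent to 0 instead of being clipped, so that
  \<open>c * cnj (cut r c)\<close> is the squared modulus of \<open>cut r c\<close>. This is what
  the test in \<open>total_cv\<close> needs.\<close>

definition cut :: "real \<Rightarrow> complex \<Rightarrow> complex" where
  "cut r c = (if cmod c \<le> r then c else 0)"

lemma cut_meas [measurable]: "cut r \<in> borel_measurable borel"
  unfolding cut_def by measurable

lemma norm_cut: "cmod (cut r c) \<le> \<bar>r\<bar>" by (auto simp: cut_def)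

lemma norm_cut_le: "cmod (cut r c) \<le> cmod c" by (simp add: cut_def)

lemma bfun_cut: "f \<in> borel_measurable M \<Longrightarrow> bfun (\<lambda>x. cut r (f x))"
  unfolding bfun_def using norm_cut by (auto intro!: exI[of _ "\<bar>r\<bar>"])

lemma hinner_cv:
  assumes f: "sq_integrable N f" and b: "ess_bounded M b" and k: "k \<in> carrier G"
  shows "hinner (L2 N) (L2_class N f) (cv k b) = (\<integral>x. f (x, k) * cnj (b x) \<partial>M)"
proof -
  have s: "sq_integrable N (col k b)" by (intro sq_integrable_col ess_sq b k)
  have [measurable]: "f \<in> borel_measurable N" "col k b \<in> borel_measurable N"
    using f s by (auto simp: sq_integrable_def)
  have "(\<integral>z. f z * cnj (col k b z) \<partial>N) = (\<integral>x. f (x, k) * cnj (col k b (x, k)) \<partial>M)"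
    by (rule integral_slice(1)[OF _ k, of "\<lambda>z. f z * cnj (col k b z)"]) (measurable, simp add: col_def)
  then show ?thesis unfolding cv_def hinner_class[OF f s] by (simp add: col_def)
qed

text \<open>In each slice the difference \<open>d\<close> is tested against its own truncations,
  which are bounded. All truncations vanish almost everywhere, and each value of \<open>d\<close> is
  reached at some level.\<close>

lemma total_cv:
  assumes \<xi>: "\<xi> \<in> hcarrier (L2 N)" and \<eta>: "\<eta> \<in> hcarrier (L2 N)"
    and eq: "\<And>k b. k \<in> carrier G \<Longrightarrow> bfun b \<Longrightarrow> hinner (L2 N) \<xi> (cv k b) = hinner (L2 N) \<eta> (cv k b)"
  shows "\<xi> = \<eta>"
proof -
  obtain f g where f: "sq_integrable N f" "\<xi> = L2_class N f" and g: "sq_integrable N g" "\<eta> = L2_class N g"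
    using \<xi> \<eta> by (metis L2_cases)
  have "AE x in M. f (x, k) = g (x, k)" if k: "k \<in> carrier G" for k
  proof -
    define d where "d x = f (x, k) - g (x, k)" for x
    note sf = sq_integrable_slice[OF f(1) k] and sg = sq_integrable_slice[OF g(1) k]
    have sd: "sq_integrable M d"
      unfolding d_def by (rule sq_integrable_diff[OF sf sg])
    then have m: "d \<in> borel_measurable M" by (simp add: sq_integrable_def)
    have "AE x in M. cut (real n) (d x) = 0" for n
    proof -
      note b = bfun_cut[OF m, of "real n"]
      have sb: "sq_integrable M (\<lambda>x. cut (real n) (d x))" by (intro ess_sq bfun_ess b)
      have "(\<integral>x. f (x, k) * cnj (cut (real n) (d x)) \<partial>M) = (\<integral>x. g (x, k) * cnj (cut (real n) (d x)) \<partial>M)"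
        using eq[OF k b] unfolding f(2) g(2) hinner_cv[OF f(1) bfun_ess[OF b] k] hinner_cv[OF g(1) bfun_ess[OF b] k] .
      then have "(\<integral>x. f (x, k) * cnj (cut (real n) (d x)) - g (x, k) * cnj (cut (real n) (d x)) \<partial>M) = 0"
        using Bochner_Integration.integral_diff[OF integrable_mult_cnj[OF sf sb] integrable_mult_cnj[OF sg sb]] by simp
      moreover have "f (x, k) * cnj (cut (real n) (d x)) - g (x, k) * cnj (cut (real n) (d x))
          = complex_of_real ((cmod (cut (real n) (d x)))\<^sup>2)" for x
        unfolding complex_norm_square
        by (simp add: cut_def d_def left_diff_distrib)
      ultimately have "(\<integral>x. (cmod (cut (real n) (d x)))\<^sup>2 \<partial>M) = 0"
        by (simp only: integral_complex_of_real of_real_eq_0_iff)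
      then show ?thesis
        using integral_nonneg_eq_0_iff_AE[OF sq_integrable_int[OF sb]] by simp
    qed
    then have "AE x in M. \<forall>n. cut (real n) (d x) = 0" by (simp add: AE_all_countable)
    then show ?thesis
    proof eventually_elim
      case (elim x)
      obtain n :: nat where "cmod (d x) \<le> real n" using real_arch_simple by blast
      then have "d x = 0" using elim[rule_format, of n] by (simp add: cut_def)
      then show ?case by (simp add: d_def)
    qed
  qed
  then have "AE z in N. f z = g z" by (simp add: AE_N_iff)
  then show ?thesis using L2_class_cong f g by blast
qed

text \<open>A bijection because G is infinite, so each step of a partial sum along it adds exactly
  one new slice.\<close>

definition enum :: "nat \<Rightarrow> 'g" where "enum = from_nat_into (carrier G)"

lemma enum_bij: "bij_betw enum UNIV (carrier G)"
  unfolding enum_def by (rule bij_betw_from_nat_into[OF countable_G infinite_G])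

lemma enum_carrier [simp, intro]: "enum n \<in> carrier G"
  using enum_bij by (auto simp: bij_betw_def)

lemma enum_inj [simp]: "enum n = enum m \<longleftrightarrow> n = m"
  using enum_bij by (auto simp: bij_betw_def inj_on_def)

lemma enum_surj: "k \<in> carrier G \<Longrightarrow> \<exists>n. k = enum n"
  using enum_bij by (auto simp: bij_betw_def)

lemma eq_on_cv:
  assumes A: "A \<in> bounded_operators (L2 N)" and B: "B \<in> bounded_operators (L2 N)"
    and eq: "\<And>k b. k \<in> carrier G \<Longrightarrow> bfun b \<Longrightarrow> A (cv k b) = B (cv k b)"
  shows "A = B"
proof (rule bounded_op_eqI[OF A B])
  fix \<xi> assume "\<xi> \<in> hcarrier (L2 N)"
  then obtain f where f: "sq_integrable N f" "\<xi> = L2_class N f" by (metis L2_cases)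
  have fm [measurable]: "f \<in> borel_measurable N" using f by (simp add: sq_integrable_def)
  \<comment> \<open>Two cutoffs make a finite sum of bounded columns: \<open>m\<close> limits the
    slices, \<open>r\<close> the modulus. The induction runs over \<open>m\<close> at fixed
    \<open>r\<close>, the limit along the diagonal m = r = n.\<close>
  define F where "F m r z = (if snd z \<in> enum ` {..<m} then cut r (f z) else 0)" for m r z
  have Fm: "F m r \<in> borel_measurable N" for m r
  proof (rule meas_N)
    fix k assume k: "k \<in> carrier G"
    have "(\<lambda>x. cut r (f (x, k))) \<in> borel_measurable M"
      by (rule measurable_compose[OF meas_slice[OF fm k] cut_meas])
    then show "(\<lambda>x. F m r (x, k)) \<in> borel_measurable M" by (simp add: F_def)
  qed
  have Fle: "cmod (F m r z) \<le> cmod (f z)" for m r z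
    using norm_cut_le by (simp add: F_def)
  have Fs: "sq_integrable N (F m r)" for m r
    by (rule sq_integrable_bound[OF f(1) Fm, where c = 1]) (use Fle in simp)
  have AB: "A (L2_class N (F m r)) = B (L2_class N (F m r))" for m r
  proof (induction m)
    case 0
    have "L2_class N (F 0 r) = cv \<one> (\<lambda>_. 0)"
      unfolding cv_def by (rule arg_cong[of _ _ "L2_class N"]) (auto simp: F_def col_def)
    then show ?case using eq[of \<one> "\<lambda>_. 0"] by simp
  next
    case (Suc m)
    let ?b = "\<lambda>x. cut r (f (x, enum m))"
    have b: "bfun ?b" by (rule bfun_cut[OF meas_slice[OF fm enum_carrier]])
    have bs: "sq_integrable N (col (enum m) ?b)"
      by (intro sq_integrable_col ess_sq bfun_ess b enum_carrier)
    have "F (Suc m) r = (\<lambda>z. F m r z + col (enum m) ?b z)"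
      by (auto simp: F_def col_def fun_eq_iff lessThan_Suc)
    then have e: "L2_class N (F (Suc m) r) = hadd (L2 N) (L2_class N (F m r)) (cv (enum m) ?b)"
      unfolding cv_def using hadd_class[OF Fs bs, of m r] by simp
    have c: "L2_class N (F m r) \<in> hcarrier (L2 N)" "cv (enum m) ?b \<in> hcarrier (L2 N)"
      using Fs cv_carrier[OF bfun_ess[OF b] enum_carrier] by auto
    show ?case
      unfolding e bounded_op_add[OF A c] bounded_op_add[OF B c] Suc.IH eq[OF enum_carrier b] ..
  qed
  have lim: "hlim (L2 N) (\<lambda>n. L2_class N (F n (real n))) (L2_class N f)"
  proof (rule hlim_dominated(3)[OF Fm fm f(1)])
    show "AE z in N. (\<lambda>n. F n (real n) z) \<longlonglongrightarrow> f z"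
    proof (rule AE_I2)
      fix z assume "z \<in> space N"
      then have "snd z \<in> carrier G" by (auto simp: space_pair_measure)
      then obtain m where m: "snd z = enum m" using enum_surj by blast
      obtain r :: nat where r: "cmod (f z) \<le> real r" using real_arch_simple by blast
      have "\<forall>\<^sub>F n in sequentially. F n (real n) z = f z"
        using eventually_gt_at_top[of "max m r"]
        by eventually_elim (use m r in \<open>auto simp: F_def cut_def\<close>)
      then show "(\<lambda>n. F n (real n) z) \<longlonglongrightarrow> f z" by (rule tendsto_eventually)
    qed
    show "AE z in N. cmod (F n (real n) z) \<le> cmod (f z)" for n using Fle by simp
  qed
  have cF: "L2_class N (F n (real n)) \<in> hcarrier (L2 N)" for n using Fs by blast
  have cf: "L2_class N f \<in> hcarrier (L2 N)" using f(1) by blast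
  have lA: "hlim (L2 N) (\<lambda>n. A (L2_class N (F n (real n)))) (A (L2_class N f))"
    by (rule hlim_bounded_op[OF A lim cF cf])
  have lB: "hlim (L2 N) (\<lambda>n. A (L2_class N (F n (real n)))) (B (L2_class N f))"
    unfolding AB by (rule hlim_bounded_op[OF B lim cF cf])
  show "A \<xi> = B \<xi>"
    unfolding f(2) by (rule hlim_unique[OF lA lB bounded_op_carrier[OF A cF] bounded_op_carrier[OF A cf] bounded_op_carrier[OF B cf]])
qed

text \<open>\<Omega> is separating: its right translates are the bounded columns, which determine a
  bounded operator. Below, equalities between elements of the algebra are proved by evaluating at
  \<Omega>.\<close>

lemma right_commutant_eqI: "x \<in> right_commutant \<Longrightarrow> y \<in> right_commutant \<Longrightarrow> x \<Omega> = y \<Omega> \<Longrightarrow> x = y"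
  by (rule eq_on_cv) (auto simp: right_commutant_bounded right_commutant_cv)

lemma right_commutant_op_mult: "x \<in> right_commutant \<Longrightarrow> y \<in> right_commutant \<Longrightarrow> op_mult (L2 N) x y \<in> right_commutant"
  unfolding right_commutant_def by (rule commutant_op_mult[OF right_ops_bounded])

lemma right_commutant_op_add: "x \<in> right_commutant \<Longrightarrow> y \<in> right_commutant \<Longrightarrow> op_add (L2 N) x y \<in> right_commutant"
  unfolding right_commutant_def by (rule commutant_op_add[OF right_ops_bounded])

subsection \<open>Adjoints and the trace\<close>

text \<open>Followed by complex conjugation this is the modular conjugation: the adjoint of a u_k is
  the function conj(a) moved by k^-1, times u_{k^-1}.\<close>

definition flip :: "'x \<times> 'g \<Rightarrow> 'x \<times> 'g" where
  "flip z = (\<sigma> (inv (snd z)) (fst z), inv (snd z))"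

lemma mpt_flip: "mpt N flip"
proof -
  have "bij_betw (\<lambda>k. inv k) (carrier G) (carrier G)"
    by (rule bij_betwI[where g = "\<lambda>k. inv k"]) auto
  then have "mpt N (\<lambda>z. (\<sigma> (inv (snd z)) (fst z), inv (snd z)))"
    by (intro mpt_N) auto
  then show ?thesis by (simp add: flip_def[abs_def])
qed

lemma sq_integrable_cnj: "sq_integrable K f \<Longrightarrow> sq_integrable K (\<lambda>z. cnj (f z))"
  by (auto simp: sq_integrable_def intro: measurable_compose[OF _ borel_measurable_cnj])

lemma sq_flip: "sq_integrable N f \<Longrightarrow> sq_integrable N (\<lambda>z. cnj (f (flip z)))"
  by (intro sq_integrable_cnj sq_integrable_comp[OF mpt_flip])

lemma adjoint_\<Omega>:
  assumes x: "x \<in> right_commutant" and y: "y \<in> right_commutant" and adj: "is_adjoint (L2 N) x y"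
    and f: "sq_integrable N f" "x \<Omega> = L2_class N f"
  shows "y \<Omega> = L2_class N (\<lambda>z. cnj (f (flip z)))"
proof (rule total_cv)
  show "y \<Omega> \<in> hcarrier (L2 N)" by (rule bounded_op_carrier[OF right_commutant_bounded[OF y] \<Omega>_carrier])
  show "L2_class N (\<lambda>z. cnj (f (flip z))) \<in> hcarrier (L2 N)" using sq_flip[OF f(1)] by blast
  fix h b assume h: "h \<in> carrier G" and b: "bfun b"
  have c: "cv h b \<in> hcarrier (L2 N)" by (intro cv_carrier bfun_ess b h)
  have fm: "f \<in> borel_measurable N" using f by (simp add: sq_integrable_def)
  have o: "ess_bounded M (\<lambda>_. 1)" by (intro bfun_ess bfun_const)
  have "hinner (L2 N) (y \<Omega>) (cv h b) = hinner (L2 N) \<Omega> (x (cv h b))"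
    using is_adjoint_sym[OF adj right_commutant_bounded[OF x] right_commutant_bounded[OF y]] c by (simp add: is_adjoint_def)
  also have "x (cv h b) = L2_class N (\<lambda>z. b (\<sigma> (h \<otimes> inv (snd z)) (fst z)) * f (fst z, snd z \<otimes> inv h))"
    unfolding right_commutant_cv[OF x b h] f(2) by (rule right_op_class[OF b h f(1)])
  also have "hinner (L2 N) \<Omega> \<dots> = cnj (hinner (L2 N) \<dots> \<Omega>)"
    by (rule hinner_sym) (use right_op_sq[OF b h f(1)] in blast)+
  also have "\<dots> = cnj (\<integral>x. b (\<sigma> (h \<otimes> inv \<one>) x) * f (x, \<one> \<otimes> inv h) * cnj 1 \<partial>M)"
    unfolding \<Omega>_def hinner_cv[OF right_op_sq[OF b h f(1)] o one_closed] by simp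
  also have "\<dots> = (\<integral>x. cnj (b (\<sigma> h x)) * cnj (f (x, inv h)) \<partial>M)"
    using h by (simp flip: Bochner_Integration.integral_cnj)
  \<comment> \<open>The integrand is written as a function of \<sigma> h x, so that invariance of
    the measure moves the translation from \<open>b\<close> to \<open>f\<close>.\<close>
  also have "\<dots> = (\<integral>x. (\<lambda>x. cnj (f (\<sigma> (inv h) x, inv h)) * cnj (b x)) (\<sigma> h x) \<partial>M)"
    by (rule Bochner_Integration.integral_cong) (use h in \<open>auto simp: mult.commute\<close>)
  also have "\<dots> = (\<integral>x. cnj (f (\<sigma> (inv h) x, inv h)) * cnj (b x) \<partial>M)"
  proof (rule mpt_integral(1)[OF \<sigma>_mpt[OF h]])
    have "(\<lambda>x. f (\<sigma> (inv h) x, inv h)) \<in> borel_measurable M"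
      using h by (intro measurable_compose[OF \<sigma>_meas meas_slice[OF fm]]) auto
    then show "(\<lambda>x. cnj (f (\<sigma> (inv h) x, inv h)) * cnj (b x)) \<in> borel_measurable M"
      using bfun_meas[OF b] by measurable
  qed
  also have "\<dots> = hinner (L2 N) (L2_class N (\<lambda>z. cnj (f (flip z)))) (cv h b)"
    unfolding hinner_cv[OF sq_flip[OF f(1)] bfun_ess[OF b] h] by (simp add: flip_def)
  finally show "hinner (L2 N) (y \<Omega>) (cv h b) = hinner (L2 N) (L2_class N (\<lambda>z. cnj (f (flip z)))) (cv h b)" .
qed

text \<open>The trace property in terms of coefficients: an element and its adjoint have the same
  norm at \<Omega>, because \<open>flip\<close> preserves the measure.\<close>

lemma hnorm_flip:
  assumes "sq_integrable N f"
  shows "hnorm (L2 N) (L2_class N (\<lambda>z. cnj (f (flip z)))) = hnorm (L2 N) (L2_class N f)"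
proof -
  have m: "(\<lambda>z. (cmod (f z))\<^sup>2) \<in> borel_measurable N"
    using sq_integrable_meas[OF assms] by measurable
  show ?thesis
    unfolding hnorm_class[OF sq_flip[OF assms]] hnorm_class[OF assms]
    using mpt_integral(1)[OF mpt_flip m] by simp
qed

lemma hlim_adjoint_\<Omega>:
  assumes x: "\<And>n. x n \<in> right_commutant" "\<And>n. x' n \<in> right_commutant" "\<And>n. is_adjoint (L2 N) (x n) (x' n)"
    and y: "y \<in> right_commutant" "y' \<in> right_commutant" "is_adjoint (L2 N) y y'"
    and lim: "hlim (L2 N) (\<lambda>n. x n \<Omega>) (y \<Omega>)"
  shows "hlim (L2 N) (\<lambda>n. x' n \<Omega>) (y' \<Omega>)"
proof -
  have "\<exists>f. sq_integrable N f \<and> x n \<Omega> = L2_class N f" for n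
    using bounded_op_carrier[OF right_commutant_bounded[OF x(1)] \<Omega>_carrier] by (metis L2_cases)
  then obtain f where f: "\<And>n. sq_integrable N (f n)" "\<And>n. x n \<Omega> = L2_class N (f n)" by metis
  obtain g where g: "sq_integrable N g" "y \<Omega> = L2_class N g"
    using bounded_op_carrier[OF right_commutant_bounded[OF y(1)] \<Omega>_carrier] by (metis L2_cases)
  have "hnorm (L2 N) (hadd (L2 N) (x' n \<Omega>) (hscale (L2 N) (-1) (y' \<Omega>)))
      = hnorm (L2 N) (hadd (L2 N) (x n \<Omega>) (hscale (L2 N) (-1) (y \<Omega>)))" for n
  proof -
    have d: "sq_integrable N (\<lambda>z. f n z - g z)" by (intro sq_integrable_diff f g)
    have e: "hadd (L2 N) (L2_class N u) (hscale (L2 N) (-1) (L2_class N v)) = L2_class N (\<lambda>z. u z - v z)"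
      if "sq_integrable N u" "sq_integrable N v" for u v
      using hadd_class[OF that(1) sq_integrable_scale[OF that(2), of "-1"]] by (simp add: hscale_class[OF that(2)])
    have "hadd (L2 N) (x' n \<Omega>) (hscale (L2 N) (-1) (y' \<Omega>)) = L2_class N (\<lambda>z. cnj (f n (flip z) - g (flip z)))"
      unfolding adjoint_\<Omega>[OF x(1,2,3) f] adjoint_\<Omega>[OF y g] e[OF sq_flip[OF f(1)] sq_flip[OF g(1)]] by simp
    then show ?thesis
      unfolding f(2) g(2) e[OF f(1) g(1)] using hnorm_flip[OF d] by simp
  qed
  with lim show ?thesis by (simp add: hlim_def)
qed

text \<open>A bounded column is a bounded operator applied to \<Omega>, and this operator commutes
  with every \<open>x n\<close> and with \<open>y\<close>; so convergence spreads from \<Omega> to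
  the column.\<close>

lemma hlim_right_commutant_cv:
  assumes "\<And>n. x n \<in> right_commutant" "y \<in> right_commutant" "hlim (L2 N) (\<lambda>n. x n \<Omega>) (y \<Omega>)" "bfun b" "k \<in> carrier G"
  shows "hlim (L2 N) (\<lambda>n. x n (cv k b)) (y (cv k b))"
proof -
  have "hlim (L2 N) (\<lambda>n. right_op k b (x n \<Omega>)) (right_op k b (y \<Omega>))"
    by (rule hlim_bounded_op[OF right_op_bounded[OF assms(4,5)] assms(3)])
       (simp_all add: bounded_op_carrier[OF right_commutant_bounded[OF assms(1)]] bounded_op_carrier[OF right_commutant_bounded[OF assms(2)]])
  then show ?thesis using assms by (simp add: right_commutant_cv)
qed

text \<open>Convergence on \<open>\<Omega>\<close> alone gives no bound on the operator norms.  It does give convergence, for the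
  sequence and for its adjoints, on the bounded columns, and that suffices for commutation.\<close>

lemma commutes_limit:
  assumes x: "\<And>n. x n \<in> right_commutant" "\<And>n. x' n \<in> right_commutant" "\<And>n. is_adjoint (L2 N) (x n) (x' n)"
    and y: "y \<in> right_commutant" "y' \<in> right_commutant" "is_adjoint (L2 N) y y'"
    and lim: "hlim (L2 N) (\<lambda>n. x n \<Omega>) (y \<Omega>)"
    and T: "T \<in> bounded_operators (L2 N)"
    and comm: "\<And>n \<xi>. \<xi> \<in> hcarrier (L2 N) \<Longrightarrow> T (x n \<xi>) = x n (T \<xi>)"
    and \<xi>: "\<xi> \<in> hcarrier (L2 N)"
  shows "T (y \<xi>) = y (T \<xi>)"
proof -
  note yb = right_commutant_bounded[OF y(1)] and xb = right_commutant_bounded[OF x(1)]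
  have "op_mult (L2 N) T y = op_mult (L2 N) y T"
  proof (rule eq_on_cv)
    fix k b assume k: "k \<in> carrier G" and b: "bfun b"
    let ?\<eta> = "cv k b"
    have \<eta>: "?\<eta> \<in> hcarrier (L2 N)" by (intro cv_carrier bfun_ess b k)
    note T\<eta> = bounded_op_carrier[OF T \<eta>]
    have "T (y ?\<eta>) = y (T ?\<eta>)"
    proof (rule total_cv)
      fix h c assume h: "h \<in> carrier G" and c: "bfun c"
      let ?\<zeta> = "cv h c"
      have \<zeta>: "?\<zeta> \<in> hcarrier (L2 N)" by (intro cv_carrier bfun_ess c h)
      \<comment> \<open>With <.,.> the inner product, <T x_n \<eta>, \<zeta>> = <x_n T \<eta>,
        \<zeta>> = <T \<eta>, x'_n \<zeta>>. Since T \<eta> need not be a bounded column, x_n T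
        \<eta> is out of control; the adjoint shifts x_n to the bounded column \<zeta>, and both
        ends of the chain converge.\<close>
      have "hlim (L2 N) (\<lambda>n. T (x n ?\<eta>)) (T (y ?\<eta>))"
        by (rule hlim_bounded_op[OF T hlim_right_commutant_cv[of x y, OF x(1) y(1) lim b k]])
           (rule bounded_op_carrier[OF xb \<eta>] bounded_op_carrier[OF yb \<eta>])+
      then have "(\<lambda>n. hinner (L2 N) (T (x n ?\<eta>)) ?\<zeta>) \<longlonglongrightarrow> hinner (L2 N) (T (y ?\<eta>)) ?\<zeta>"
        by (rule hlim_inner)
           (rule bounded_op_carrier[OF T bounded_op_carrier[OF xb \<eta>]] bounded_op_carrier[OF T bounded_op_carrier[OF yb \<eta>]] \<zeta>)+
      moreover have "hinner (L2 N) (T (x n ?\<eta>)) ?\<zeta> = hinner (L2 N) (T ?\<eta>) (x' n ?\<zeta>)" for n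
        using x(3)[of n] comm[OF \<eta>, of n] T\<eta> \<zeta> by (simp add: is_adjoint_def)
      moreover have "hlim (L2 N) (\<lambda>n. x' n ?\<zeta>) (y' ?\<zeta>)"
        by (rule hlim_right_commutant_cv[of x' y', OF x(2) y(2) hlim_adjoint_\<Omega>[OF x y lim] c h])
      then have "(\<lambda>n. hinner (L2 N) (T ?\<eta>) (x' n ?\<zeta>)) \<longlonglongrightarrow> hinner (L2 N) (T ?\<eta>) (y' ?\<zeta>)"
        by (rule hlim_inner_right)
           (rule bounded_op_carrier[OF right_commutant_bounded[OF x(2)] \<zeta>] bounded_op_carrier[OF right_commutant_bounded[OF y(2)] \<zeta>] T\<eta>)+
      ultimately have "hinner (L2 N) (T (y ?\<eta>)) ?\<zeta> = hinner (L2 N) (T ?\<eta>) (y' ?\<zeta>)"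
        using LIMSEQ_unique by simp
      also have "\<dots> = hinner (L2 N) (y (T ?\<eta>)) ?\<zeta>"
        using y(3) T\<eta> \<zeta> by (simp add: is_adjoint_def)
      finally show "hinner (L2 N) (T (y ?\<eta>)) ?\<zeta> = hinner (L2 N) (y (T ?\<eta>)) ?\<zeta>" .
    qed (use \<eta> T\<eta> in \<open>auto intro: bounded_op_carrier[OF T] bounded_op_carrier[OF yb]\<close>)
    then show "op_mult (L2 N) T y ?\<eta> = op_mult (L2 N) y T ?\<eta>"
      using \<eta> by (simp add: compose_eq)
  qed (intro op_mult_bounded T yb)+
  then have "op_mult (L2 N) T y \<xi> = op_mult (L2 N) y T \<xi>" by simp
  then show ?thesis using \<xi> by (simp add: compose_eq)
qed

lemma mult_adjoint:
  assumes a: "ess_bounded M a"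
  shows "is_adjoint (L2 N) (mult_op G M a) (mult_op G M (\<lambda>x. cnj (a x)))" "ess_bounded M (\<lambda>x. cnj (a x))"
proof -
  show c: "ess_bounded M (\<lambda>x. cnj (a x))"
    using a by (auto simp: ess_bounded_def intro: measurable_compose[OF _ borel_measurable_cnj])
  show "is_adjoint (L2 N) (mult_op G M a) (mult_op G M (\<lambda>x. cnj (a x)))"
    unfolding is_adjoint_def
  proof (intro ballI)
    fix \<xi> \<eta> assume "\<xi> \<in> hcarrier (L2 N)" "\<eta> \<in> hcarrier (L2 N)"
    then obtain f g where f: "sq_integrable N f" "\<xi> = L2_class N f" and g: "sq_integrable N g" "\<eta> = L2_class N g"
      by (metis L2_cases)
    show "hinner (L2 N) (mult_op G M a \<xi>) \<eta> = hinner (L2 N) \<xi> (mult_op G M (\<lambda>x. cnj (a x)) \<eta>)"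
      unfolding f(2) g(2) mult_class[OF a f(1)] mult_class[OF c g(1)]
        hinner_class[OF mult_sq[OF a f(1)] g(1)] hinner_class[OF f(1) mult_sq[OF c g(1)]]
      by (simp add: mult_ac)
  qed
qed

lemma group_adjoint:
  assumes g: "g \<in> carrier G"
  shows "is_adjoint (L2 N) (group_op G M \<sigma> g) (group_op G M \<sigma> (inv g))"
  unfolding is_adjoint_def
proof (intro ballI)
  fix \<xi> \<eta> assume "\<xi> \<in> hcarrier (L2 N)" "\<eta> \<in> hcarrier (L2 N)"
  then obtain f e where f: "sq_integrable N f" "\<xi> = L2_class N f" and e: "sq_integrable N e" "\<eta> = L2_class N e"
    by (metis L2_cases)
  have g': "inv g \<in> carrier G" using g by simp
  have m: "(\<lambda>z. f z * cnj (e (\<sigma> (inv (inv g)) (fst z), inv (inv g) \<otimes> snd z))) \<in> borel_measurable N"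
    using sq_integrable_meas[OF f(1)] sq_integrable_meas[OF group_sq[OF g' e(1)]] by measurable
  have "hinner (L2 N) \<xi> (group_op G M \<sigma> (inv g) \<eta>)
      = (\<integral>z. f z * cnj (e (\<sigma> (inv (inv g)) (fst z), inv (inv g) \<otimes> snd z)) \<partial>N)"
    unfolding f(2) e(2) group_class[OF g' e(1)] by (rule hinner_class[OF f(1) group_sq[OF g' e(1)]])
  also have "\<dots> = (\<integral>z. f (\<sigma> (inv g) (fst z), inv g \<otimes> snd z) * cnj (e (\<sigma> (inv (inv g)) (\<sigma> (inv g) (fst z)), inv (inv g) \<otimes> (inv g \<otimes> snd z))) \<partial>N)"
    using mpt_integral(1)[OF group_t[OF g] m] by simp
  also have "\<dots> = (\<integral>z. f (\<sigma> (inv g) (fst z), inv g \<otimes> snd z) * cnj (e z) \<partial>N)"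
    by (rule Bochner_Integration.integral_cong) (use g in \<open>auto simp: space_pair_measure m_assoc[symmetric]\<close>)
  also have "\<dots> = hinner (L2 N) (group_op G M \<sigma> g \<xi>) \<eta>"
    unfolding f(2) e(2) group_class[OF g f(1)] by (rule hinner_class[OF group_sq[OF g f(1)] e(1), symmetric])
  finally show "hinner (L2 N) (group_op G M \<sigma> g \<xi>) \<eta> = hinner (L2 N) \<xi> (group_op G M \<sigma> (inv g) \<eta>)" ..
qed

subsection \<open>Fourier coefficients\<close>

text \<open>\<open>au a k\<close> is the element \<open>a u\<^sub>k\<close> of the crossed product.\<close>

definition au :: "('x \<Rightarrow> complex) \<Rightarrow> 'g \<Rightarrow> ('x \<times> 'g \<Rightarrow> complex) set \<Rightarrow> ('x \<times> 'g \<Rightarrow> complex) set" where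
  "au a k = op_mult (L2 N) (mult_op G M a) (group_op G M \<sigma> k)"

lemma au_right_commutant: "ess_bounded M a \<Longrightarrow> k \<in> carrier G \<Longrightarrow> au a k \<in> right_commutant"
  unfolding au_def by (intro right_commutant_op_mult mult_right_commutant group_right_commutant)

lemma group_cv:
  assumes a: "ess_bounded M a" and k: "k \<in> carrier G" and h: "h \<in> carrier G"
  shows "group_op G M \<sigma> h (cv k a) = cv (h \<otimes> k) (\<lambda>x. a (\<sigma> (inv h) x))"
proof -
  have s: "sq_integrable N (col k a)" by (intro sq_integrable_col ess_sq a k)
  have e: "inv h \<otimes> j = k \<longleftrightarrow> j = h \<otimes> k" if "j \<in> carrier G" for j
    using that k h by (metis inv_solve_left)
  show ?thesis unfolding cv_def group_class[OF h s]
    by (rule L2_class_cong_space[OF group_sq[OF h s], THEN conjunct1]) (simp add: col_def e)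
qed

lemma mult_cv:
  assumes a: "ess_bounded M a" and b: "ess_bounded M b" and k: "k \<in> carrier G"
  shows "mult_op G M a (cv k b) = cv k (\<lambda>x. a x * b x)"
proof -
  have s: "sq_integrable N (col k b)" by (intro sq_integrable_col ess_sq b k)
  show ?thesis unfolding cv_def mult_class[OF a s]
    by (rule arg_cong[of _ _ "L2_class N"]) (auto simp: col_def)
qed

lemma one_ess: "ess_bounded M (\<lambda>_. 1)" by (intro bfun_ess bfun_const)

lemma group_\<Omega>: "k \<in> carrier G \<Longrightarrow> group_op G M \<sigma> k \<Omega> = cv k (\<lambda>_. 1)"
  unfolding \<Omega>_def using group_cv[OF one_ess one_closed, of k] by simp

lemma au_\<Omega>: "ess_bounded M a \<Longrightarrow> k \<in> carrier G \<Longrightarrow> au a k \<Omega> = cv k a"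
  unfolding au_def by (simp add: compose_eq group_\<Omega> mult_cv one_ess)

text \<open>A limit is accepted by \<open>commutes_limit\<close> only together with an adjoint in
  \<open>right_commutant\<close>. For a u_k the witness is u_{k^-1} conj(a).\<close>

lemma au_adjoint:
  assumes a: "ess_bounded M a" and k: "k \<in> carrier G"
  shows "\<exists>y\<in>right_commutant. is_adjoint (L2 N) (au a k) y"
proof
  show "is_adjoint (L2 N) (au a k) (op_mult (L2 N) (group_op G M \<sigma> (inv k)) (mult_op G M (\<lambda>x. cnj (a x))))"
    unfolding au_def using a k
    by (intro is_adjoint_op_mult mult_adjoint group_adjoint mult_bounded group_bounded inv_closed)
  show "op_mult (L2 N) (group_op G M \<sigma> (inv k)) (mult_op G M (\<lambda>x. cnj (a x))) \<in> right_commutant"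
    using a k by (intro right_commutant_op_mult group_right_commutant mult_right_commutant mult_adjoint inv_closed)
qed

text \<open>An operator bound \<open>C\<close> also bounds each coefficient. On the set
  \<open>E\<close> where the coefficient exceeds \<open>C\<close> in modulus, applying x to a
  suitable indicator gives integral of |f|^2 over \<open>E\<close> at most C^2 times the measure of
  \<open>E\<close>, which forces \<open>E\<close> to be null.\<close>

lemma coefficient_ess_bounded:
  assumes x: "x \<in> right_commutant" and f: "sq_integrable N f" "x \<Omega> = L2_class N f" and k: "k \<in> carrier G"
  shows "ess_bounded M (\<lambda>y. f (y, k))"
proof -
  obtain C where C: "0 \<le> C" "\<And>\<xi>. \<xi> \<in> hcarrier (L2 N) \<Longrightarrow> hnorm (L2 N) (x \<xi>) \<le> C * hnorm (L2 N) \<xi>"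
    using bounded_op_bound[OF right_commutant_bounded[OF x]] by metis
  have fk: "sq_integrable M (\<lambda>y. f (y, k))" by (rule sq_integrable_slice[OF f(1) k])
  have [measurable]: "(\<lambda>y. f (y, k)) \<in> borel_measurable M" by (rule sq_integrable_meas[OF fk])
  define E where "E = {y \<in> space M. C < cmod (f (y, k))}"
  have E [measurable]: "E \<in> sets M" unfolding E_def by measurable
  \<comment> \<open>The translate by k is chosen so that u_k b = 1_E u_k: in slice k the weight
    becomes exactly the indicator of \<open>E\<close>.\<close>
  define b where "b y = (indicator E (\<sigma> k y) :: complex)" for y
  have b: "bfun b" unfolding b_def by (intro bfun_comp bfun_indicator E k)
  let ?g = "\<lambda>z. b (\<sigma> (\<one> \<otimes> inv (snd z)) (fst z)) * f (fst z, snd z \<otimes> inv \<one>)"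
  have gs: "sq_integrable N ?g" by (rule right_op_sq[OF b one_closed f(1)])
  have xg: "x (cv \<one> b) = L2_class N ?g"
    unfolding right_commutant_cv[OF x b one_closed] f(2) by (rule right_op_class[OF b one_closed f(1)])
  let ?h = "\<lambda>y. indicator E y * (cmod (f (y, k)))\<^sup>2"
  have ih: "integrable M ?h"
  by (rule Bochner_Integration.integrable_bound[OF sq_integrable_int[OF fk]]) (auto simp: indicator_def)
  have cm: "(\<lambda>z. if snd z = k then ?h (fst z) else 0) \<in> borel_measurable N"
    by (rule meas_N) simp
  have "(\<integral>y. ?h y \<partial>M) = (\<integral>z. (if snd z = k then ?h (fst z) else 0) \<partial>N)"
    using integral_slice(1)[OF cm k] by simp
  also have "\<dots> \<le> (\<integral>z. (cmod (?g z))\<^sup>2 \<partial>N)"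
  proof (rule integral_mono)
    show "integrable N (\<lambda>z. (if snd z = k then ?h (fst z) else 0))"
      using integral_slice(2)[OF cm k] ih by simp
    show "integrable N (\<lambda>z. (cmod (?g z))\<^sup>2)" by (rule sq_integrable_int[OF gs])
    fix z assume z: "z \<in> space N"
    then obtain y j where zy: "z = (y, j)" "y \<in> space M" "j \<in> carrier G" by (auto simp: space_pair_measure)
    show "(if snd z = k then ?h (fst z) else 0) \<le> (cmod (?g z))\<^sup>2"
      using zy k by (auto simp: b_def indicator_def)
  qed
  also have "\<dots> = (hnorm (L2 N) (x (cv \<one> b)))\<^sup>2"
    unfolding xg hnorm_class[OF gs] by simp
  also have "\<dots> \<le> (C * hnorm (L2 N) (cv \<one> b))\<^sup>2"
    using b by (intro power_mono C hnorm_nonneg bounded_op_carrier[OF right_commutant_bounded[OF x]] cv_carrier bfun_ess) auto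
  also have "\<dots> = C\<^sup>2 * (hnorm (L2 N) (cv \<one> b))\<^sup>2" by (simp add: power_mult_distrib)
  also have "(hnorm (L2 N) (cv \<one> b))\<^sup>2 = (\<integral>y. (cmod (b y))\<^sup>2 \<partial>M)"
  proof -
    have s: "sq_integrable N (col \<one> b)" by (intro sq_integrable_col ess_sq bfun_ess b one_closed)
    have "(\<integral>z. (cmod (col \<one> b z))\<^sup>2 \<partial>N) = (\<integral>y. (cmod (col \<one> b (y, \<one>)))\<^sup>2 \<partial>M)"
      using sq_integrable_meas[OF s] by (intro integral_slice(1)) (measurable, auto simp: col_def)
    then show ?thesis unfolding cv_def hnorm_class[OF s] by (simp add: col_def)
  qed
  also have "(\<integral>y. (cmod (b y))\<^sup>2 \<partial>M) = (\<integral>y. (\<lambda>y. indicator E y :: real) (\<sigma> k y) \<partial>M)"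
    by (rule Bochner_Integration.integral_cong) (auto simp: b_def indicator_def)
  also have "\<dots> = (\<integral>y. indicator E y \<partial>M)"
    by (rule mpt_integral(1)[OF \<sigma>_mpt[OF k]]) measurable
  finally have le: "(\<integral>y. ?h y \<partial>M) \<le> C\<^sup>2 * (\<integral>y. indicator E y \<partial>M)" .
  \<comment> \<open>A nonnegative function, strictly positive on \<open>E\<close>, whose integral is
    at most 0 by \<open>le\<close>.\<close>
  let ?d = "\<lambda>y. ?h y - C\<^sup>2 * indicator E y"
  have iE: "integrable M (\<lambda>y. C\<^sup>2 * indicator E y :: real)"
    by (intro integrable_mult_right integrable_real_indicator E) (simp add: emeasure_eq_measure)
  have nn: "0 \<le> ?d y" for y
    using C(1) power_mono[of C "cmod (f (y, k))" 2] by (auto simp: E_def indicator_def)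
  have "(\<integral>y. ?d y \<partial>M) = (\<integral>y. ?h y \<partial>M) - C\<^sup>2 * (\<integral>y. indicator E y \<partial>M)"
    using ih iE by simp
  then have "(\<integral>y. ?d y \<partial>M) = 0"
    using le Bochner_Integration.integral_nonneg[of M ?d] nn by simp
  then have "AE y in M. ?d y = 0"
    using ih iE nn by (subst (asm) integral_nonneg_eq_0_iff_AE) auto
  moreover have "AE y in M. y \<in> space M" by simp
  ultimately have "AE y in M. cmod (f (y, k)) \<le> C"
  proof eventually_elim
    case (elim y)
    show ?case
    proof (rule ccontr)
      assume "\<not> cmod (f (y, k)) \<le> C"
      then have "y \<in> E" "C\<^sup>2 < (cmod (f (y, k)))\<^sup>2"
        using elim C(1) by (auto simp: E_def power_strict_mono)
      then show False using elim by simp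
    qed
  qed
  then show ?thesis by (auto simp: ess_bounded_def)
qed

end

section \<open>Separating points by countably many measurable sets\<close>

lemma standard_separating_sequence:
  assumes "standard_probability_space M"
  obtains E :: "nat \<Rightarrow> 'x set" where "\<And>n. E n \<in> sets M"
    "\<And>x y. x \<in> space M \<Longrightarrow> y \<in> space M \<Longrightarrow> x \<noteq> y \<Longrightarrow> \<exists>n. (x \<in> E n) \<noteq> (y \<in> E n)"
proof -
  obtain T where T: "completely_metrizable_space T" "second_countable T" "topspace T = space M"
    "sets M = sigma_sets (topspace T) {U. openin T U}"
    using assms by (auto simp: standard_probability_space_def)
  obtain B where B: "countable B" "\<And>V. V \<in> B \<Longrightarrow> openin T V"
    "\<And>U x. openin T U \<Longrightarrow> x \<in> U \<Longrightarrow> \<exists>V\<in>B. x \<in> V \<and> V \<subseteq> U"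
    using T(2) unfolding second_countable_def by metis
  have haus: "Hausdorff_space T"
    using T(1) completely_metrizable_imp_metrizable_space metrizable_imp_Hausdorff_space by blast
  \<comment> \<open>The empty set is added so that the countable set is nonempty, as
    \<open>range_from_nat_into\<close> requires.\<close>
  define E where "E = from_nat_into (insert {} B)"
  have r: "range E = insert {} B" unfolding E_def using B(1) by (intro range_from_nat_into) auto
  show thesis
  proof
    show "E n \<in> sets M" for n
    proof -
      have "E n \<in> insert {} B" using r by blast
      then have "openin T (E n)" using B(2) by auto
      then show ?thesis unfolding T(4) by (intro sigma_sets.Basic) simp
    qed
    fix x y assume "x \<in> space M" "y \<in> space M" "x \<noteq> y"
    then obtain U V where UV: "openin T U" "openin T V" "x \<in> U" "y \<in> V" "disjnt U V"
      using haus T(3) unfolding Hausdorff_space_def by metis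
    obtain W where W: "W \<in> B" "x \<in> W" "W \<subseteq> U" using B(3)[OF UV(1,3)] by blast
    obtain n where "W = E n" using r W(1) by (metis insertI2 rangeE)
    moreover have "y \<notin> W" using W UV by (auto simp: disjnt_iff)
    ultimately show "\<exists>n. (x \<in> E n) \<noteq> (y \<in> E n)" using W(2) by blast
  qed
qed

section \<open>Computations at the trace vector, and mixing\<close>

context pmp_system
begin

lemma cv_cong_AE:
  assumes "ess_bounded M a" "ess_bounded M b" "k \<in> carrier G" "AE x in M. a x = b x"
  shows "cv k a = cv k b"
  unfolding cv_def
proof (rule L2_class_cong)
  show "AE z in N. col k a z = col k b z"
    unfolding AE_N_iff col_def using assms(4) by auto
qed (use assms in \<open>auto intro!: sq_integrable_col ess_sq\<close>)

lemma cv_add: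
  assumes "ess_bounded M a" "ess_bounded M b" "k \<in> carrier G"
  shows "hadd (L2 N) (cv k a) (cv k b) = cv k (\<lambda>x. a x + b x)"
proof -
  have s: "sq_integrable N (col k a)" "sq_integrable N (col k b)"
    using assms by (auto intro!: sq_integrable_col ess_sq)
  show ?thesis
    unfolding cv_def hadd_class[OF s] by (rule arg_cong[of _ _ "L2_class N"]) (auto simp: col_def)
qed

lemma op_add_\<Omega>: "op_add (L2 N) x y \<Omega> = hadd (L2 N) (x \<Omega>) (y \<Omega>)"
  by (simp add: op_add_def)

lemma ess_indicator: "A \<in> sets M \<Longrightarrow> ess_bounded M (indicator A)"
  by (intro bfun_ess bfun_indicator)

lemma mult_au:
  assumes a: "ess_bounded M a" and b: "ess_bounded M b" and k: "k \<in> carrier G" and ab: "ess_bounded M (\<lambda>x. a x * b x)"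
  shows "op_mult (L2 N) (mult_op G M a) (au b k) = au (\<lambda>x. a x * b x) k"
  by (rule right_commutant_eqI) (use assms in \<open>simp_all add: right_commutant_op_mult mult_right_commutant au_right_commutant compose_eq au_\<Omega> mult_cv\<close>)

text \<open>Since u_j b = \<sigma>_j(b) u_j, the coefficient of a x b at j is a times \<sigma>_j(b)
  times the coefficient of x.\<close>

lemma sandwich_\<Omega>:
  assumes x: "x \<in> right_commutant" and f: "sq_integrable N f" "x \<Omega> = L2_class N f"
    and a: "bfun a" and b: "bfun b"
  shows "op_mult (L2 N) (op_mult (L2 N) (mult_op G M a) x) (mult_op G M b) \<Omega>
      = L2_class N (\<lambda>z. a (fst z) * (b (\<sigma> (inv (snd z)) (fst z)) * f z))"
    "sq_integrable N (\<lambda>z. a (fst z) * (b (\<sigma> (inv (snd z)) (fst z)) * f z))"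
proof -
  let ?g = "\<lambda>z. b (\<sigma> (\<one> \<otimes> inv (snd z)) (fst z)) * f (fst z, snd z \<otimes> inv \<one>)"
  have g: "sq_integrable N ?g" by (rule right_op_sq[OF b one_closed f(1)])
  have bO: "mult_op G M b \<Omega> = cv \<one> b"
    unfolding \<Omega>_def by (simp add: mult_cv[OF bfun_ess[OF b] one_ess one_closed])
  have "op_mult (L2 N) (op_mult (L2 N) (mult_op G M a) x) (mult_op G M b) \<Omega> = mult_op G M a (x (cv \<one> b))"
    using cv_carrier[OF bfun_ess[OF b] one_closed] by (simp add: compose_eq bO)
  also have "\<dots> = L2_class N (\<lambda>z. a (fst z) * ?g z)"
    unfolding right_commutant_cv[OF x b one_closed] f(2) right_op_class[OF b one_closed f(1)] by (rule mult_class[OF bfun_ess[OF a] g])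
  finally have 1: "op_mult (L2 N) (op_mult (L2 N) (mult_op G M a) x) (mult_op G M b) \<Omega> = L2_class N (\<lambda>z. a (fst z) * ?g z)" .
  have 2: "L2_class N (\<lambda>z. a (fst z) * ?g z) = L2_class N (\<lambda>z. a (fst z) * (b (\<sigma> (inv (snd z)) (fst z)) * f z))
      \<and> sq_integrable N (\<lambda>z. a (fst z) * (b (\<sigma> (inv (snd z)) (fst z)) * f z))"
    by (rule L2_class_cong_space[OF mult_sq[OF bfun_ess[OF a] g]]) simp
  show "op_mult (L2 N) (op_mult (L2 N) (mult_op G M a) x) (mult_op G M b) \<Omega>
      = L2_class N (\<lambda>z. a (fst z) * (b (\<sigma> (inv (snd z)) (fst z)) * f z))"
    "sq_integrable N (\<lambda>z. a (fst z) * (b (\<sigma> (inv (snd z)) (fst z)) * f z))"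
    using 1 2 by auto
qed

text \<open>\<open>mixing_action\<close> speaks of images, while measurability and invariance of the
  measure concern preimages.\<close>

lemma image_\<sigma>: "h \<in> carrier G \<Longrightarrow> B \<in> sets M \<Longrightarrow> \<sigma> h ` B = \<sigma> (inv h) -` B \<inter> space M"
proof -
  assume h: "h \<in> carrier G" and B: "B \<in> sets M"
  have s: "B \<subseteq> space M" using B by (rule sets.sets_into_space)
  show ?thesis
  proof (intro equalityI subsetI)
    fix y assume "y \<in> \<sigma> (inv h) -` B \<inter> space M"
    then have "\<sigma> (inv h) y \<in> B" "y = \<sigma> h (\<sigma> (inv h) y)" using h by auto
    then show "y \<in> \<sigma> h ` B" by blast
  qed (use h s in auto)
qed

lemma image_\<sigma>_sets: "h \<in> carrier G \<Longrightarrow> B \<in> sets M \<Longrightarrow> \<sigma> h ` B \<in> sets M"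
  unfolding image_\<sigma> by (rule measurable_sets[OF \<sigma>_meas]) auto

lemma measure_image_\<sigma>: "h \<in> carrier G \<Longrightarrow> B \<in> sets M \<Longrightarrow> measure M (\<sigma> h ` B) = measure M B"
proof -
  assume h: "h \<in> carrier G" and B: "B \<in> sets M"
  have "measure (distr M M (\<sigma> (inv h))) B = measure M (\<sigma> (inv h) -` B \<inter> space M)"
    using h B by (intro measure_distr) auto
  then show ?thesis
    using \<sigma>_mpt[of "inv h"] h B by (simp add: image_\<sigma> mpt_def)
qed

text \<open>An injective enumeration of \<open>W\<close> tends to infinity in G. Invariance keeps
  the translates of \<open>B\<close> disjoint from the complement of \<open>B\<close>, so the mixing
  limit, the product of the measures of \<open>B\<close> and of its complement, is 0.\<close>

lemma mixing_full_measure: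
  assumes mix: "mixing_action G M \<sigma>" and W: "W \<subseteq> carrier G" "infinite W" and B: "B \<in> sets M"
    and inv: "\<And>h. h \<in> W \<Longrightarrow> \<sigma> h ` B \<subseteq> B" and pos: "measure M B \<noteq> 0"
  shows "AE x in M. x \<in> B"
proof -
  define e where "e = from_nat_into W"
  have cW: "countable W" using countable_G W(1) by (rule countable_subset[rotated])
  have e: "bij_betw e UNIV W" unfolding e_def by (rule bij_betw_from_nat_into[OF cW W(2)])
  have eW: "e n \<in> W" for n using e by (auto simp: bij_betw_def)
  have "filterlim e cofinite sequentially"
    unfolding filterlim_iff
  proof (intro allI impI)
    fix Q :: "'g \<Rightarrow> bool" assume "eventually Q cofinite"
    then have "finite {x. \<not> Q x}" by (simp add: eventually_cofinite)
    then have "finite (e -` {x. \<not> Q x})"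
      by (rule finite_vimageI) (use e in \<open>simp add: bij_betw_def\<close>)
    then have "eventually (\<lambda>n. Q (e n)) cofinite" by (simp add: eventually_cofinite vimage_def)
    then show "\<forall>\<^sub>F n in sequentially. Q (e n)" by (simp add: cofinite_eq_sequentially)
  qed
  moreover have "filterlim e (principal (carrier G)) sequentially"
    using eW W(1) by (auto simp: filterlim_principal intro!: always_eventually)
  ultimately have fe: "filterlim e (inf cofinite (principal (carrier G))) sequentially"
    by (simp add: filterlim_inf)
  let ?C = "space M - B"
  have C: "?C \<in> sets M" using B by auto
  have "((\<lambda>g. measure M (\<sigma> g ` B \<inter> ?C)) \<longlongrightarrow> measure M B * measure M ?C) (inf cofinite (principal (carrier G)))"
    using mix B C unfolding mixing_action_def by blast
  from filterlim_compose[OF this fe]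
  have "(\<lambda>n. measure M (\<sigma> (e n) ` B \<inter> ?C)) \<longlonglongrightarrow> measure M B * measure M ?C" .
  moreover have "\<sigma> (e n) ` B \<inter> ?C = {}" for n using inv[OF eW[of n]] by blast
  ultimately have "measure M B * measure M ?C = 0" by (simp add: LIMSEQ_const_iff)
  then have "measure M ?C = 0" using pos by simp
  then have "emeasure M ?C = 0" by (simp add: emeasure_eq_measure)
  then have "?C \<in> null_sets M" using C by auto
  then show ?thesis by (rule AE_I') auto
qed

end

section \<open>Intermediate subalgebras\<close>

locale intermediate_algebra = pmp_system G M \<sigma>
  for G :: "('g, 'm) monoid_scheme" (structure) and M :: "'x measure" and \<sigma> +
  fixes H :: "'g set" and P :: "(('x \<times> 'g \<Rightarrow> complex) set \<Rightarrow> ('x \<times> 'g \<Rightarrow> complex) set) set"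
  assumes vN: "von_neumann_algebra (L2 N) P"
    and rn: "roughly_normal G H"
    and std: "standard_probability_space M"
    and free: "free_action G M \<sigma>"
    and mix: "mixing_action G M \<sigma>"
    and lower: "crossed_product G M \<sigma> H \<subseteq> P"
    and upper: "P \<subseteq> crossed_product G M \<sigma> (carrier G)"
begin

lemma H_subgroup: "subgroup H G" using rn by (simp add: roughly_normal_def)

lemma H_carrier: "H \<subseteq> carrier G" by (rule subgroup.subset[OF H_subgroup])

lemma P_right_commutant: "x \<in> P \<Longrightarrow> x \<in> right_commutant" using upper crossed_product_right_commutant by blast

lemma P_comm: "commutant (L2 N) (commutant (L2 N) P) = P"
  using vN by (simp add: von_neumann_algebra_def)

lemma P_adjoint: "x \<in> P \<Longrightarrow> \<exists>y\<in>P. is_adjoint (L2 N) x y"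
  using vN by (simp add: von_neumann_algebra_def)

lemma commutant_P_bounded: "commutant (L2 N) P \<subseteq> bounded_operators (L2 N)"
  by (auto simp: commutant_def)

lemma P_mult: "x \<in> P \<Longrightarrow> y \<in> P \<Longrightarrow> op_mult (L2 N) x y \<in> P"
  using commutant_op_mult[OF commutant_P_bounded, of x y] by (simp add: P_comm)

lemma P_add: "x \<in> P \<Longrightarrow> y \<in> P \<Longrightarrow> op_add (L2 N) x y \<in> P"
  using commutant_op_add[OF commutant_P_bounded, of x y] by (simp add: P_comm)

lemma gens_P: "gens H \<subseteq> P"
  using commutant_commutant_incl[OF gens_bounded[OF H_carrier]] lower by (simp add: crossed_product_eq)

lemma mult_P: "ess_bounded M a \<Longrightarrow> mult_op G M a \<in> P"
  using gens_P by (auto simp: gens_def)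

lemma group_P: "h \<in> H \<Longrightarrow> group_op G M \<sigma> h \<in> P"
  using gens_P by (auto simp: gens_def)

text \<open>P equals its double commutant, so only commutation with each T in the commutant of P has
  to survive the limit, and \<open>commutes_limit\<close> provides this. The adjoints of the
  \<open>x n\<close> exist because P is closed under adjoints.\<close>

lemma P_limit:
  assumes x: "\<And>n. x n \<in> P" and y: "y \<in> right_commutant" "\<exists>y'\<in>right_commutant. is_adjoint (L2 N) y y'"
    and lim: "hlim (L2 N) (\<lambda>n. x n \<Omega>) (y \<Omega>)"
  shows "y \<in> P"
proof -
  obtain y' where y': "y' \<in> right_commutant" "is_adjoint (L2 N) y y'" using y(2) by blast
  obtain x' where x': "\<And>n. x' n \<in> P" "\<And>n. is_adjoint (L2 N) (x n) (x' n)"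
    using P_adjoint[OF x] by metis
  have "y \<in> commutant (L2 N) (commutant (L2 N) P)"
  proof (rule commutantI)
    fix T \<xi> assume T: "T \<in> commutant (L2 N) P" and \<xi>: "\<xi> \<in> hcarrier (L2 N)"
    have "T (y \<xi>) = y (T \<xi>)"
      by (rule commutes_limit[of x x' y y', OF P_right_commutant[OF x] P_right_commutant[OF x'(1)] x'(2) y(1) y' lim
            commutantD(1)[OF T] commutantD(2)[OF T x] \<xi>])
    then show "y (T \<xi>) = T (y \<xi>)" ..
  qed (rule right_commutant_bounded[OF y(1)])
  then show ?thesis by (simp add: P_comm)
qed

lemma pinching:
  assumes x: "x \<in> P" and f: "sq_integrable N f" "x \<Omega> = L2_class N f"
    and k: "k \<in> carrier G" and E: "E \<in> sets M"
  defines "f' \<equiv> \<lambda>z. if fst z \<in> E \<longleftrightarrow> \<sigma> (k \<otimes> inv (snd z)) (fst z) \<in> E then f z else 0"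
  shows "\<exists>x'\<in>P. sq_integrable N f' \<and> x' \<Omega> = L2_class N f'"
proof -
  let ?C = "space M - E"
  \<comment> \<open>\<open>?b\<close> is the indicator of k^-1 E; in slice j it acts as y -> 1_E(k
    j^-1 y). Adding the analogous term for the complement keeps \<open>f\<close> exactly where y and
    k j^-1 y lie on the same side of \<open>E\<close>.\<close>
  let ?a = "indicator E" and ?b = "\<lambda>y. indicator E (\<sigma> k y)"
  let ?a' = "indicator ?C" and ?b' = "\<lambda>y. indicator ?C (\<sigma> k y)"
  have C: "?C \<in> sets M" using E by auto
  have b: "bfun ?a" "bfun ?b" "bfun ?a'" "bfun ?b'"
    using E C k by (auto intro!: bfun_indicator bfun_comp)
  let ?s = "\<lambda>a b. op_mult (L2 N) (op_mult (L2 N) (mult_op G M a) x) (mult_op G M b)"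
  let ?y = "op_add (L2 N) (?s ?a ?b) (?s ?a' ?b')"
  have "?y \<in> P" using x b by (intro P_add P_mult mult_P bfun_ess)
  note s1 = sandwich_\<Omega>[OF P_right_commutant[OF x] f b(1,2)] and s2 = sandwich_\<Omega>[OF P_right_commutant[OF x] f b(3,4)]
  have "?y \<Omega> = L2_class N (\<lambda>z. ?a (fst z) * (?b (\<sigma> (inv (snd z)) (fst z)) * f z)
      + ?a' (fst z) * (?b' (\<sigma> (inv (snd z)) (fst z)) * f z))"
    unfolding op_add_\<Omega> s1(1) s2(1) by (rule hadd_class[OF s1(2) s2(2)])
  moreover have "L2_class N (\<lambda>z. ?a (fst z) * (?b (\<sigma> (inv (snd z)) (fst z)) * f z)
      + ?a' (fst z) * (?b' (\<sigma> (inv (snd z)) (fst z)) * f z)) = L2_class N f' \<and> sq_integrable N f'"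
    by (rule L2_class_cong_space[OF sq_integrable_add[OF s1(2) s2(2)]])
       (use k in \<open>auto simp: f'_def indicator_def\<close>)
  ultimately show ?thesis using \<open>?y \<in> P\<close> by auto
qed

text \<open>Pinching along ever finer partitions kills every coefficient at \<open>j \<noteq> k\<close>, since \<open>k j\<^sup>-\<^sup>1\<close> has almost
  no fixed points.\<close>

lemma coefficient_P:
  assumes x: "x \<in> P" and f: "sq_integrable N f" "x \<Omega> = L2_class N f" and k: "k \<in> carrier G"
  shows "au (\<lambda>y. f (y, k)) k \<in> P"
proof -
  obtain E :: "nat \<Rightarrow> 'x set" where E: "\<And>n. E n \<in> sets M"
    "\<And>x y. x \<in> space M \<Longrightarrow> y \<in> space M \<Longrightarrow> x \<noteq> y \<Longrightarrow> \<exists>n. (x \<in> E n) \<noteq> (y \<in> E n)"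
    using standard_separating_sequence[OF std] by metis
  \<comment> \<open>Pinching along the partition generated by n sets is carried out as n successive
    pinchings into two pieces; \<open>F n\<close> keeps the points whose translate the first n sets
    do not separate from them.\<close>
  define F where "F n z = (if \<forall>i<n. fst z \<in> E i \<longleftrightarrow> \<sigma> (k \<otimes> inv (snd z)) (fst z) \<in> E i then f z else 0)" for n z
  have ex: "\<exists>x\<in>P. sq_integrable N (F n) \<and> x \<Omega> = L2_class N (F n)" for n
  proof (induction n)
    case 0
    have "F 0 = f" by (auto simp: F_def)
    then show ?case using x f by auto
  next
    case (Suc n)
    then obtain y where y: "y \<in> P" "sq_integrable N (F n)" "y \<Omega> = L2_class N (F n)" by blast
    have e: "F (Suc n) = (\<lambda>z. if fst z \<in> E n \<longleftrightarrow> \<sigma> (k \<otimes> inv (snd z)) (fst z) \<in> E n then F n z else 0)"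
      unfolding F_def fun_eq_iff less_Suc_eq by auto
    show ?case unfolding e by (rule pinching[OF y k E(1)])
  qed
  then obtain X where X: "\<And>n. X n \<in> P" "\<And>n. sq_integrable N (F n)" "\<And>n. X n \<Omega> = L2_class N (F n)"
    by metis
  have a: "ess_bounded M (\<lambda>y. f (y, k))" by (rule coefficient_ess_bounded[OF P_right_commutant[OF x] f k])
  have "hlim (L2 N) (\<lambda>n. L2_class N (F n)) (L2_class N (col k (\<lambda>y. f (y, k))))"
  proof (rule hlim_dominated(3)[OF sq_integrable_meas[OF X(2)] _ f(1)])
    show "col k (\<lambda>y. f (y, k)) \<in> borel_measurable N"
      by (rule sq_integrable_meas[OF sq_integrable_col[OF ess_sq[OF a] k]])
    show "AE z in N. cmod (F n z) \<le> cmod (f z)" for n by (simp add: F_def)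
    show "AE z in N. (\<lambda>n. F n z) \<longlonglongrightarrow> col k (\<lambda>y. f (y, k)) z"
      unfolding AE_N_iff
    proof
      fix j assume j: "j \<in> carrier G"
      show "AE x in M. (\<lambda>n. F n (x, j)) \<longlonglongrightarrow> col k (\<lambda>y. f (y, k)) (x, j)"
      proof (cases "j = k")
        case True
        show ?thesis by (rule AE_I2) (use k True in \<open>simp add: F_def col_def\<close>)
      next
        case False
        have "k \<otimes> inv j \<noteq> \<one>" using False j k by (metis inv_closed inv_equality inv_inv)
        then have "AE x in M. \<sigma> (k \<otimes> inv j) x \<noteq> x"
          using free j k by (simp add: free_action_def)
        moreover have "AE x in M. x \<in> space M" by simp
        ultimately show ?thesis
        proof eventually_elim
          case (elim x)
          then obtain i where i: "(x \<in> E i) \<noteq> (\<sigma> (k \<otimes> inv j) x \<in> E i)"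
            using E(2)[of x "\<sigma> (k \<otimes> inv j) x"] j k by auto
          have "\<forall>\<^sub>F n in sequentially. F n (x, j) = 0"
            using eventually_gt_at_top[of i] by eventually_elim (use i in \<open>auto simp: F_def\<close>)
          then have "(\<lambda>n. F n (x, j)) \<longlonglongrightarrow> 0" by (rule tendsto_eventually)
          then show ?case using False by (simp add: col_def)
        qed
      qed
    qed
  qed
  then have "hlim (L2 N) (\<lambda>n. X n \<Omega>) (au (\<lambda>y. f (y, k)) k \<Omega>)"
    unfolding X(3) au_\<Omega>[OF a k] cv_def .
  then show ?thesis
    by (rule P_limit[OF X(1) au_right_commutant[OF a k] au_adjoint[OF a k]])
qed

section \<open>From a corner 1_B u_g in P to the unitary u_g\<close>

definition corner_sets :: "'g \<Rightarrow> 'x set set" where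
  "corner_sets g = {B \<in> sets M. au (indicator B) g \<in> P}"

text \<open>P contains the bounded functions on X, so the functions a with a u_g in P form an ideal;
  passing to a measurable subset is multiplication by an indicator.\<close>

lemma corner_sets_Int: "g \<in> carrier G \<Longrightarrow> B \<in> corner_sets g \<Longrightarrow> C \<in> sets M \<Longrightarrow> C \<inter> B \<in> corner_sets g"
proof -
  assume g: "g \<in> carrier G" and B: "B \<in> corner_sets g" and C: "C \<in> sets M"
  have CB: "(\<lambda>x. indicator C x * indicator B x :: complex) = indicator (C \<inter> B)"
    by (auto simp: indicator_def)
  have "op_mult (L2 N) (mult_op G M (indicator C)) (au (indicator B) g) = au (indicator (C \<inter> B)) g"
    using mult_au[of "indicator C" "indicator B" g] g B C ess_indicator[of "C \<inter> B"]
    unfolding CB by (simp add: corner_sets_def ess_indicator sets.Int)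
  moreover have "op_mult (L2 N) (mult_op G M (indicator C)) (au (indicator B) g) \<in> P"
    using B C by (intro P_mult mult_P ess_indicator) (auto simp: corner_sets_def)
  ultimately show ?thesis using B C by (auto simp: corner_sets_def)
qed

text \<open>Indicators add up only for disjoint sets, hence the passage from \<open>B\<close> to
  \<open>B - A\<close>.\<close>

lemma corner_sets_Un: "g \<in> carrier G \<Longrightarrow> A \<in> corner_sets g \<Longrightarrow> B \<in> corner_sets g \<Longrightarrow> A \<union> B \<in> corner_sets g"
proof -
  assume g: "g \<in> carrier G" and A: "A \<in> corner_sets g" and B: "B \<in> corner_sets g"
  have sA: "A \<in> sets M" and sB: "B \<in> sets M" using A B by (auto simp: corner_sets_def)
  have "(space M - A) \<inter> B \<in> corner_sets g" using g B sA by (intro corner_sets_Int) auto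
  moreover have "(space M - A) \<inter> B = B - A" using sets.sets_into_space[OF sB] by blast
  ultimately have D: "B - A \<in> corner_sets g" by simp
  have sD: "B - A \<in> sets M" using sA sB by auto
  have e: "(\<lambda>x. indicator A x + indicator (B - A) x :: complex) = indicator (A \<union> B)"
    by (auto simp: indicator_def)
  have "op_add (L2 N) (au (indicator A) g) (au (indicator (B - A)) g) = au (indicator (A \<union> B)) g"
  proof (rule right_commutant_eqI)
    show "op_add (L2 N) (au (indicator A) g) (au (indicator (B - A)) g) \<Omega> = au (indicator (A \<union> B)) g \<Omega>"
      using g sA sB sD by (simp add: op_add_\<Omega> au_\<Omega> ess_indicator cv_add e)
  qed (use g sA sB sD in \<open>auto intro!: right_commutant_op_add au_right_commutant ess_indicator\<close>)
  moreover have "op_add (L2 N) (au (indicator A) g) (au (indicator (B - A)) g) \<in> P"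
    using A D by (intro P_add) (auto simp: corner_sets_def)
  ultimately show ?thesis using sA sB by (auto simp: corner_sets_def)
qed

lemma corner_sets_UN:
  assumes g: "g \<in> carrier G" and B: "\<And>n::nat. B n \<in> corner_sets g"
  shows "(\<Union>n. B n) \<in> corner_sets g"
proof -
  let ?U = "\<Union>n. B n"
  \<comment> \<open>The finite unions increase, so their indicators converge pointwise, dominated by
    the constant 1 in the column at g.\<close>
  define C where "C n = (\<Union>i\<le>n. B i)" for n
  have C: "C n \<in> corner_sets g" for n
  proof (induction n)
    case 0 show ?case using B[of 0] by (simp add: C_def)
  next
    case (Suc n)
    have "C (Suc n) = C n \<union> B (Suc n)" by (auto simp: C_def atMost_Suc)
    then show ?case using corner_sets_Un[OF g Suc B[of "Suc n"]] by simp
  qed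
  have sC: "C n \<in> sets M" for n using C by (simp add: corner_sets_def)
  have sU: "?U \<in> sets M" using B by (auto simp: corner_sets_def)
  have "hlim (L2 N) (\<lambda>n. L2_class N (col g (indicator (C n)))) (L2_class N (col g (indicator ?U)))"
  proof (rule hlim_dominated(3)[of _ _ _ "col g (\<lambda>_. 1)"])
    show "col g (indicator (C n)) \<in> borel_measurable N" for n
      using sC by (intro col_meas bfun_meas bfun_indicator)
    show "col g (indicator ?U) \<in> borel_measurable N"
      using sU by (intro col_meas bfun_meas bfun_indicator)
    show "sq_integrable N (col g (\<lambda>_. 1))" by (intro sq_integrable_col ess_sq one_ess g)
    show "AE z in N. cmod (col g (indicator (C n)) z) \<le> cmod (col g (\<lambda>_. 1) z)" for n
      by (simp add: col_def indicator_def)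
    have lim: "(\<lambda>n. indicator (C n) x :: complex) \<longlonglongrightarrow> indicator ?U x" for x
    proof (cases "x \<in> ?U")
      case True
      then obtain m where m: "x \<in> B m" by blast
      have "\<forall>\<^sub>F n in sequentially. (indicator (C n) x :: complex) = indicator ?U x"
        using eventually_ge_at_top[of m] by eventually_elim (use m True in \<open>auto simp: C_def indicator_def\<close>)
      then show ?thesis by (rule tendsto_eventually)
    next
      case False
      then show ?thesis by (simp add: C_def indicator_def)
    qed
    show "AE z in N. (\<lambda>n. col g (indicator (C n)) z) \<longlonglongrightarrow> col g (indicator ?U) z"
      using lim by (simp add: col_def)
  qed
  then have lim: "hlim (L2 N) (\<lambda>n. au (indicator (C n)) g \<Omega>) (au (indicator ?U) g \<Omega>)"
    using sC sU g by (simp add: au_\<Omega> ess_indicator cv_def)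
  have CP: "au (indicator (C n)) g \<in> P" for n using C by (simp add: corner_sets_def)
  have "au (indicator ?U) g \<in> P"
    by (rule P_limit[OF CP au_right_commutant[OF ess_indicator[OF sU] g] au_adjoint[OF ess_indicator[OF sU] g] lim])
  then show ?thesis using sU by (simp add: corner_sets_def)
qed

text \<open>With h' = (g^-1 h g)^-1 one has h g h' = g, so u_h (1_B u_g) u_h' = 1_{hB} u_g. The two
  conditions on h put both outer unitaries into P.\<close>

lemma corner_sets_image:
  assumes g: "g \<in> carrier G" and B: "B \<in> corner_sets g" and h: "h \<in> H" "inv g \<otimes> h \<otimes> g \<in> H"
  shows "\<sigma> h ` B \<in> corner_sets g"
proof -
  let ?h = "inv (inv g \<otimes> h \<otimes> g)"
  have hc: "h \<in> carrier G" using h H_carrier by blast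
  have h'H: "?h \<in> H" by (rule subgroup.m_inv_closed[OF H_subgroup h(2)])
  have h'c: "?h \<in> carrier G" using h'H H_carrier by blast
  have sB: "B \<in> sets M" using B by (simp add: corner_sets_def)
  have sh: "\<sigma> h ` B \<in> sets M" by (rule image_\<sigma>_sets[OF hc sB])
  let ?y = "op_mult (L2 N) (group_op G M \<sigma> h) (op_mult (L2 N) (au (indicator B) g) (group_op G M \<sigma> ?h))"
  have "h \<otimes> (g \<otimes> ?h) = g"
    using hc g by (simp add: inv_mult_group m_assoc) (simp add: m_assoc[symmetric])
  moreover have "g \<otimes> ?h \<in> carrier G" using g h'c by simp
  moreover note c1 = cv_carrier[OF one_ess h'c]
  moreover have "au (indicator B) g (cv ?h (\<lambda>_. 1)) = cv (g \<otimes> ?h) (indicator B)"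
    unfolding au_def using c1 group_cv[OF one_ess h'c g] mult_cv[OF ess_indicator[OF sB] one_ess, of "g \<otimes> ?h"] g h'c
    by (simp add: compose_eq)
  ultimately have "?y \<Omega> = cv g (\<lambda>x. indicator B (\<sigma> (inv h) x))"
    using group_cv[OF ess_indicator[OF sB], of "g \<otimes> ?h" h] hc h'c by (simp add: compose_eq group_\<Omega>)
  also have "\<dots> = cv g (indicator (\<sigma> h ` B))"
  proof (rule cv_cong_AE)
    show "AE x in M. (indicator B (\<sigma> (inv h) x) :: complex) = indicator (\<sigma> h ` B) x"
      unfolding image_\<sigma>[OF hc sB] by (rule AE_I2) (simp add: indicator_def)
  qed (use hc sB sh g in \<open>auto intro!: bfun_ess bfun_comp bfun_indicator\<close>)
  also have "\<dots> = au (indicator (\<sigma> h ` B)) g \<Omega>"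
    using sh g by (simp add: au_\<Omega> ess_indicator)
  finally have "?y = au (indicator (\<sigma> h ` B)) g"
    using sh sB g hc h'c by (intro right_commutant_eqI right_commutant_op_mult group_right_commutant au_right_commutant ess_indicator)
  moreover have "?y \<in> P" using B h h'H by (intro P_mult group_P) (auto simp: corner_sets_def)
  ultimately show ?thesis using sh by (simp add: corner_sets_def)
qed

lemma group_op_P:
  assumes g: "g \<in> carrier G" and B: "B \<in> corner_sets g" and pos: "measure M B \<noteq> 0"
  shows "group_op G M \<sigma> g \<in> P"
proof -
  \<comment> \<open>This is the intersection of H with g H g^-1; it is infinite by rough normality
    applied to \<open>inv g\<close>.\<close>
  define W where "W = {h \<in> H. inv g \<otimes> h \<otimes> g \<in> H}"
  have Wc: "W \<subseteq> carrier G" using H_carrier by (auto simp: W_def)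
  have "infinite (H \<inter> (inv (inv g) <# H #> inv g))"
    using rn inv_closed[OF g] by (simp add: roughly_normal_def)
  moreover have "H \<inter> (inv (inv g) <# H #> inv g) \<subseteq> W"
  proof
    fix h assume h: "h \<in> H \<inter> (inv (inv g) <# H #> inv g)"
    then obtain k where k: "k \<in> H" "h = g \<otimes> k \<otimes> inv g"
      using g by (auto simp: r_coset_def l_coset_def)
    have "k \<in> carrier G" using k H_carrier by blast
    then have "inv g \<otimes> h \<otimes> g = k"
      unfolding k(2) using g by (simp add: m_assoc) (simp add: m_assoc[symmetric])
    then show "h \<in> W" using h k by (simp add: W_def)
  qed
  ultimately have Winf: "infinite W" using finite_subset by blast
  \<comment> \<open>Closure under products makes the union of the \<open>W\<close>-translates of
    \<open>B\<close> invariant under \<open>W\<close>.\<close>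
  have Wmult: "h \<otimes> h' \<in> W" if "h \<in> W" "h' \<in> W" for h h'
  proof -
    have c: "h \<in> carrier G" "h' \<in> carrier G" using that Wc by auto
    have "inv g \<otimes> (h \<otimes> h') \<otimes> g = (inv g \<otimes> h \<otimes> g) \<otimes> (inv g \<otimes> h' \<otimes> g)"
    proof -
      have "g \<otimes> (inv g \<otimes> (h' \<otimes> g)) = h' \<otimes> g" using c g by (simp add: m_assoc[symmetric])
      then show ?thesis using c g by (simp add: m_assoc)
    qed
    then show ?thesis using that subgroup.m_closed[OF H_subgroup] by (simp add: W_def)
  qed
  define e where "e = from_nat_into W"
  have cW: "countable W" using countable_G Wc by (rule countable_subset[rotated])
  have re: "range e = W" unfolding e_def using Winf cW by (intro range_from_nat_into) auto
  have eW: "e n \<in> W" for n using re by blast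
  let ?U = "\<Union>n. \<sigma> (e n) ` B"
  have sB: "B \<in> sets M" using B by (simp add: corner_sets_def)
  have U: "?U \<in> corner_sets g"
    using eW by (intro corner_sets_UN corner_sets_image g B) (auto simp: W_def)
  then have sU: "?U \<in> sets M" by (simp add: corner_sets_def)
  have inv: "\<sigma> h ` ?U \<subseteq> ?U" if h: "h \<in> W" for h
  proof
    fix y assume "y \<in> \<sigma> h ` ?U"
    then obtain n x where x: "x \<in> B" "y = \<sigma> h (\<sigma> (e n) x)" by blast
    obtain m where m: "h \<otimes> e n = e m" using Wmult[OF h eW[of n]] re by (metis rangeE)
    have "y = \<sigma> (e m) x"
      unfolding x(2) m[symmetric] using h eW[of n] Wc x(1) sets.sets_into_space[OF sB] by (intro \<sigma>_\<sigma>) auto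
    then show "y \<in> ?U" using x(1) by blast
  qed
  \<comment> \<open>Any one translate would do: it has the measure of \<open>B\<close>, so the union
    has positive measure.\<close>
  have "measure M B = measure M (\<sigma> (e 0) ` B)"
    using eW[of 0] Wc sB by (intro measure_image_\<sigma>[symmetric]) auto
  also have "\<dots> \<le> measure M ?U"
    using sU by (intro finite_measure_mono) auto
  finally have U0: "measure M ?U \<noteq> 0" using pos measure_nonneg[of M B] by linarith
  have AE: "AE x in M. x \<in> ?U"
    by (rule mixing_full_measure[OF mix Wc Winf sU inv U0])
  have "au (indicator ?U) g = group_op G M \<sigma> g"
  proof (rule right_commutant_eqI)
    have "cv g (indicator ?U) = cv g (\<lambda>_. 1)"
      by (rule cv_cong_AE[OF ess_indicator[OF sU] one_ess g]) (use AE in \<open>eventually_elim, simp add: indicator_def\<close>)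
    then show "au (indicator ?U) g \<Omega> = group_op G M \<sigma> g \<Omega>"
      using sU g by (simp add: au_\<Omega> ess_indicator group_\<Omega>)
  qed (use sU g in \<open>auto intro!: au_right_commutant ess_indicator group_right_commutant\<close>)
  then show ?thesis using U by (simp add: corner_sets_def)
qed

text \<open>On the set \<open>E\<close> where the coefficient has modulus above 1/(n+1) it has a
  bounded inverse; multiplying by this inverse turns the coefficient times u_g into 1_E u_g, still
  in P. If \<open>E\<close> were not null, \<open>group_op_P\<close> would put u_g into P. Letting n
  grow leaves only the value 0.\<close>

lemma coefficient_zero:
  assumes x: "x \<in> P" and f: "sq_integrable N f" "x \<Omega> = L2_class N f" and g: "g \<in> carrier G"
    and nP: "group_op G M \<sigma> g \<notin> P"
  shows "AE y in M. f (y, g) = 0"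
proof -
  have a: "ess_bounded M (\<lambda>y. f (y, g))" by (rule coefficient_ess_bounded[OF P_right_commutant[OF x] f g])
  have [measurable]: "(\<lambda>y. f (y, g)) \<in> borel_measurable M" using a by (simp add: ess_bounded_def)
  have "AE y in M. cmod (f (y, g)) \<le> inverse (real (Suc n))" for n
  proof -
    define E where "E = {y \<in> space M. inverse (real (Suc n)) < cmod (f (y, g))}"
    have E [measurable]: "E \<in> sets M" unfolding E_def by measurable
    define b where "b y = (if y \<in> E then inverse (f (y, g)) else 0)" for y
    have b: "ess_bounded M b"
    proof (rule ess_boundedI)
      show "b \<in> borel_measurable M" unfolding b_def by measurable
      show "cmod (b y) \<le> real (Suc n)" for y
        using le_imp_inverse_le[of "inverse (real (Suc n))" "cmod (f (y, g))"]
        by (auto simp: b_def E_def norm_inverse simp del: of_nat_Suc)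
    qed
    have e: "(\<lambda>y. b y * f (y, g)) = indicator E"
    proof
      fix y
      have "f (y, g) \<noteq> 0" if "y \<in> E"
      proof
        assume "f (y, g) = 0"
        then have "inverse (real (Suc n)) < 0" using that by (simp add: E_def)
        then show False by (simp del: of_nat_Suc)
      qed
      then show "b y * f (y, g) = indicator E y" by (auto simp: b_def indicator_def)
    qed
    have "op_mult (L2 N) (mult_op G M b) (au (\<lambda>y. f (y, g)) g) = au (indicator E) g"
      using mult_au[OF b a g] ess_indicator[OF E] by (simp add: e)
    moreover have "op_mult (L2 N) (mult_op G M b) (au (\<lambda>y. f (y, g)) g) \<in> P"
      by (intro P_mult mult_P b coefficient_P[OF x f g])
    ultimately have "E \<in> corner_sets g" using E by (simp add: corner_sets_def)
    then have "measure M E = 0" using group_op_P[OF g] nP by blast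
    then have "E \<in> null_sets M" using E by (auto simp: emeasure_eq_measure)
    then show ?thesis by (rule AE_I') (auto simp: E_def)
  qed
  then have "AE y in M. \<forall>n. cmod (f (y, g)) \<le> inverse (real (Suc n))" by (simp add: AE_all_countable)
  then show ?thesis
  proof eventually_elim
    case (elim y)
    show ?case
    proof (rule ccontr)
      assume "f (y, g) \<noteq> 0"
      then obtain n where "inverse (real (Suc n)) < cmod (f (y, g))" 
        using reals_Archimedean[of "cmod (f (y, g))"] by (auto simp del: of_nat_Suc)
      then show False using elim[rule_format, of n] by simp
    qed
  qed
qed

section \<open>The subgroup K and the two inclusions\<close>

definition K where "K = {g \<in> carrier G. group_op G M \<sigma> g \<in> P}"

text \<open>Inverses come from adjoints: P contains an adjoint of u_g, and by uniqueness it is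
  u_{g^-1}.\<close>

lemma K_subgroup: "subgroup K G"
proof (rule subgroupI)
  show "K \<subseteq> carrier G" by (auto simp: K_def)
  have "\<one> \<in> K" using group_P[OF subgroup.one_closed[OF H_subgroup]] by (simp add: K_def)
  then show "K \<noteq> {}" by blast
next
  fix g assume "g \<in> K"
  then have g: "g \<in> carrier G" "group_op G M \<sigma> g \<in> P" by (auto simp: K_def)
  obtain y where y: "y \<in> P" "is_adjoint (L2 N) (group_op G M \<sigma> g) y" using P_adjoint[OF g(2)] by blast
  have "y = group_op G M \<sigma> (inv g)"
    by (rule is_adjoint_unique[OF y(2) group_adjoint[OF g(1)] right_commutant_bounded[OF P_right_commutant[OF y(1)]] group_bounded[OF inv_closed[OF g(1)]]])
  then show "inv g \<in> K" using y g by (simp add: K_def)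
next
  fix g h assume "g \<in> K" "h \<in> K"
  then have g: "g \<in> carrier G" "group_op G M \<sigma> g \<in> P" and h: "h \<in> carrier G" "group_op G M \<sigma> h \<in> P"
    by (auto simp: K_def)
  have "op_mult (L2 N) (group_op G M \<sigma> g) (group_op G M \<sigma> h) = group_op G M \<sigma> (g \<otimes> h)"
    using g h group_cv[OF one_ess h(1) g(1)]
    by (intro right_commutant_eqI right_commutant_op_mult group_right_commutant m_closed) (simp_all add: compose_eq group_\<Omega>)
  then show "g \<otimes> h \<in> K" using P_mult[OF g(2) h(2)] g h by (simp add: K_def)
qed

lemma crossed_product_K_subset: "crossed_product G M \<sigma> K \<subseteq> P"
proof -
  have "gens K \<subseteq> P" by (auto simp: gens_def K_def mult_P)
  then have "commutant (L2 N) (commutant (L2 N) (gens K)) \<subseteq> commutant (L2 N) (commutant (L2 N) P)"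
    by (intro commutant_mono)
  then show ?thesis by (simp add: crossed_product_eq P_comm)
qed

text \<open>Let T commute with the generators for K. Each Fourier term of x commutes with T: for k
  in K it is a product of generators, for k outside K it vanishes. The partial sums converge to x at
  \<Omega>, and commutation passes to x.\<close>

lemma P_subset_crossed_product_K: "P \<subseteq> crossed_product G M \<sigma> K"
proof
  fix x assume x: "x \<in> P"
  note xM = P_right_commutant[OF x]
  obtain f where f: "sq_integrable N f" "x \<Omega> = L2_class N f"
    using bounded_op_carrier[OF right_commutant_bounded[OF xM] \<Omega>_carrier] by (metis L2_cases)
  have z: "ess_bounded M (\<lambda>_. 0)" by (intro bfun_ess bfun_const)
  show "x \<in> crossed_product G M \<sigma> K"
    unfolding crossed_product_eq
  proof (rule commutantI[OF right_commutant_bounded[OF xM]])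
    fix T \<xi> assume T: "T \<in> commutant (L2 N) (gens K)" and \<xi>: "\<xi> \<in> hcarrier (L2 N)"
    note Tb = commutantD(1)[OF T]
    have Tm: "T (mult_op G M a \<eta>) = mult_op G M a (T \<eta>)" if "ess_bounded M a" "\<eta> \<in> hcarrier (L2 N)" for a \<eta>
      using commutantD(2)[OF T, of "mult_op G M a"] that by (simp add: gens_def)
    have Tg: "T (group_op G M \<sigma> g \<eta>) = group_op G M \<sigma> g (T \<eta>)" if "g \<in> K" "\<eta> \<in> hcarrier (L2 N)" for g \<eta>
      using commutantD(2)[OF T, of "group_op G M \<sigma> g"] that by (simp add: gens_def)
    \<comment> \<open>Adjoints are recorded together with the commutation, because
      \<open>commutes_limit\<close> needs them for the whole sequence; so closure under sums must
      treat both.\<close>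
    define S where "S = {y \<in> right_commutant. (\<exists>y'\<in>right_commutant. is_adjoint (L2 N) y y') \<and> (\<forall>\<eta>\<in>hcarrier (L2 N). T (y \<eta>) = y (T \<eta>))}"
    have S_add: "op_add (L2 N) y z \<in> S" if yS: "y \<in> S" and zS: "z \<in> S" for y z
    proof -
      obtain y' where y': "y' \<in> right_commutant" "is_adjoint (L2 N) y y'" using yS unfolding S_def by blast
      obtain z' where z': "z' \<in> right_commutant" "is_adjoint (L2 N) z z'" using zS unfolding S_def by blast
      have yz: "y \<in> right_commutant" "z \<in> right_commutant"
        "\<And>\<eta>. \<eta> \<in> hcarrier (L2 N) \<Longrightarrow> T (y \<eta>) = y (T \<eta>)" "\<And>\<eta>. \<eta> \<in> hcarrier (L2 N) \<Longrightarrow> T (z \<eta>) = z (T \<eta>)"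
        using yS zS unfolding S_def by auto
      have "is_adjoint (L2 N) (op_add (L2 N) y z) (op_add (L2 N) y' z')"
        by (rule is_adjoint_op_add[OF y'(2) z'(2) yz(1,2)[THEN right_commutant_bounded] y'(1)[THEN right_commutant_bounded] z'(1)[THEN right_commutant_bounded]])
      moreover have "T (op_add (L2 N) y z \<eta>) = op_add (L2 N) y z (T \<eta>)" if \<eta>: "\<eta> \<in> hcarrier (L2 N)" for \<eta>
        using yz \<eta> by (simp add: op_add_def bounded_op_carrier[OF Tb] bounded_op_add[OF Tb]
            bounded_op_carrier[OF right_commutant_bounded])
      ultimately show ?thesis
        unfolding S_def using right_commutant_op_add[OF yz(1,2)] right_commutant_op_add[OF y'(1) z'(1)] by blast
    qed
    have zero_S: "mult_op G M (\<lambda>_. 0) \<in> S"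
      unfolding S_def using mult_adjoint[OF z] mult_right_commutant[OF z] Tm[OF z] by auto
    \<comment> \<open>The zero column is the same vector for every k, so a single zero operator
      serves as the empty sum and as every vanishing term.\<close>
    have zero_\<Omega>: "mult_op G M (\<lambda>_. 0) \<Omega> = cv k (\<lambda>_. 0)" for k
    proof -
      have "mult_op G M (\<lambda>_. 0) \<Omega> = cv \<one> (\<lambda>_. 0)"
        unfolding \<Omega>_def by (simp add: mult_cv[OF z one_ess one_closed])
      also have "\<dots> = cv k (\<lambda>_. 0)" unfolding cv_def col_def by (simp cong: if_cong)
      finally show ?thesis .
    qed
    have au_S: "au (\<lambda>y. f (y, k)) k \<in> S" if k: "k \<in> carrier G" for k
    proof -
      have a: "ess_bounded M (\<lambda>y. f (y, k))" by (rule coefficient_ess_bounded[OF xM f k])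
      show ?thesis
      proof (cases "k \<in> K")
        case True
        have "T (au (\<lambda>y. f (y, k)) k \<eta>) = au (\<lambda>y. f (y, k)) k (T \<eta>)" if \<eta>: "\<eta> \<in> hcarrier (L2 N)" for \<eta>
          unfolding au_def using \<eta> bounded_op_carrier[OF Tb \<eta>] bounded_op_carrier[OF group_bounded[OF k] \<eta>]
          by (simp add: compose_eq Tm[OF a] Tg[OF True])
        then show ?thesis unfolding S_def using au_right_commutant[OF a k] au_adjoint[OF a k] by blast
      next
        case False
        then have "AE y in M. f (y, k) = 0" using coefficient_zero[OF x f k] k by (simp add: K_def)
        then have "cv k (\<lambda>y. f (y, k)) = cv k (\<lambda>_. 0)" by (rule cv_cong_AE[OF a z k])
        then have "au (\<lambda>y. f (y, k)) k = mult_op G M (\<lambda>_. 0)"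
          by (intro right_commutant_eqI au_right_commutant mult_right_commutant a z k) (simp add: au_\<Omega>[OF a k] zero_\<Omega>[of k])
        then show ?thesis using zero_S by simp
      qed
    qed
    \<comment> \<open>The coefficient vector of the m-th partial Fourier sum. No cutoff of the
      values is needed here, since the coefficients of x are essentially bounded.\<close>
    define F where "F m z = (if snd z \<in> enum ` {..<m} then f z else 0)" for m z
    have Fs: "sq_integrable N (F m)" for m
    proof (rule sq_integrable_bound[OF f(1), where c = 1])
      show "F m \<in> borel_measurable N"
      proof (rule meas_N)
        fix k assume k: "k \<in> carrier G"
        show "(\<lambda>x. F m (x, k)) \<in> borel_measurable M"
          using meas_slice[OF sq_integrable_meas[OF f(1)] k]
          by (cases "k \<in> enum ` {..<m}") (simp_all add: F_def)
      qed
    qed (simp add: F_def)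
    have "\<exists>y\<in>S. y \<Omega> = L2_class N (F m)" for m
    proof (induction m)
      case 0
      have "L2_class N (F 0) = cv \<one> (\<lambda>_. 0)"
        unfolding cv_def by (rule arg_cong[of _ _ "L2_class N"]) (auto simp: F_def col_def)
      then show ?case using zero_S zero_\<Omega>[of \<one>] by auto
    next
      case (Suc m)
      then obtain y where y: "y \<in> S" "y \<Omega> = L2_class N (F m)" by blast
      let ?a = "\<lambda>y. f (y, enum m)"
      have a: "ess_bounded M ?a" by (rule coefficient_ess_bounded[OF xM f enum_carrier])
      have "F (Suc m) = (\<lambda>z. F m z + col (enum m) ?a z)"
        by (auto simp: F_def col_def fun_eq_iff lessThan_Suc)
      then have "L2_class N (F (Suc m)) = hadd (L2 N) (L2_class N (F m)) (cv (enum m) ?a)"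
        unfolding cv_def using hadd_class[OF Fs sq_integrable_col[OF ess_sq[OF a] enum_carrier], of m] by simp
      also have "\<dots> = op_add (L2 N) y (au ?a (enum m)) \<Omega>"
        by (simp add: op_add_\<Omega> y(2) au_\<Omega>[OF a enum_carrier])
      finally show ?case using S_add[OF y(1) au_S[OF enum_carrier]] by (intro bexI[of _ "op_add (L2 N) y (au ?a (enum m))"]) auto
    qed
    then obtain Y where Y: "\<And>m. Y m \<in> S" "\<And>m. Y m \<Omega> = L2_class N (F m)" by metis
    then obtain Y' where Y': "\<And>m. Y' m \<in> right_commutant" "\<And>m. is_adjoint (L2 N) (Y m) (Y' m)"
      unfolding S_def by (simp add: Bex_def) metis
    have YM: "\<And>m. Y m \<in> right_commutant" and YT: "\<And>m \<eta>. \<eta> \<in> hcarrier (L2 N) \<Longrightarrow> T (Y m \<eta>) = Y m (T \<eta>)"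
      using Y(1) unfolding S_def by auto
    obtain x' where x': "x' \<in> P" "is_adjoint (L2 N) x x'" using P_adjoint[OF x] by blast
    have lim: "hlim (L2 N) (\<lambda>m. Y m \<Omega>) (x \<Omega>)"
      unfolding Y(2) f(2)
    proof (rule hlim_dominated(3)[OF sq_integrable_meas[OF Fs] sq_integrable_meas[OF f(1)] f(1)])
      show "AE z in N. cmod (F m z) \<le> cmod (f z)" for m by (simp add: F_def)
      show "AE z in N. (\<lambda>m. F m z) \<longlonglongrightarrow> f z"
      proof (rule AE_I2)
        fix z assume "z \<in> space N"
        then have "snd z \<in> carrier G" by (auto simp: space_pair_measure)
        then obtain m where m: "snd z = enum m" using enum_surj by blast
        have "\<forall>\<^sub>F n in sequentially. F n z = f z"
          using eventually_gt_at_top[of m] by eventually_elim (use m in \<open>auto simp: F_def\<close>)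
        then show "(\<lambda>n. F n z) \<longlonglongrightarrow> f z" by (rule tendsto_eventually)
      qed
    qed
    have "T (x \<xi>) = x (T \<xi>)"
      by (rule commutes_limit[of Y Y' x x', OF YM Y' xM P_right_commutant[OF x'(1)] x'(2) lim Tb YT \<xi>])
    then show "x (T \<xi>) = T (x \<xi>)" ..
  qed
qed

lemma P_eq: "P = crossed_product G M \<sigma> K"
  using crossed_product_K_subset P_subset_crossed_product_K by blast

end

theorem lemma3p12:
  fixes G :: "('g, 'm) monoid_scheme"
    and H :: "'g set"
    and M :: "'x measure"
    and \<sigma> :: "'g \<Rightarrow> 'x \<Rightarrow> 'x"
    and P :: "(('x \<times> 'g \<Rightarrow> complex) set \<Rightarrow> ('x \<times> 'g \<Rightarrow> complex) set) set"
  assumes "group G" and "countable (carrier G)"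
    and "roughly_normal G H"
    and "standard_probability_space M"
    and "pmp_action G M \<sigma>"
    and "free_action G M \<sigma>"
    and "mixing_action G M \<sigma>"
    and "von_neumann_algebra (XG_L2 G M) P"
    and "crossed_product G M \<sigma> H \<subseteq> P"
    and "P \<subseteq> crossed_product G M \<sigma> (carrier G)"
  shows "\<exists>K. subgroup K G \<and> H \<subseteq> K \<and> P = crossed_product G M \<sigma> K"
proof -
  have "H \<subseteq> carrier G" "infinite H"
    using assms(3) subgroup.subset by (auto simp: roughly_normal_def)
  then have inf: "infinite (carrier G)" using finite_subset by blast
  have "prob_space M" using assms(4) by (simp add: standard_probability_space_def)
  then have "pmp_system G M \<sigma>"
    using assms inf by (simp add: pmp_system_def pmp_system_axioms_def)
  then interpret intermediate_algebra G M \<sigma> H P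
    using assms by (simp add: intermediate_algebra_def intermediate_algebra_axioms_def)
  have "H \<subseteq> K" using H_carrier group_P by (auto simp: K_def)
  then show ?thesis using K_subgroup P_eq by blast
qed

end
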